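(* Let $q\ge 3$ be a prime power, $n\ge 3$, and $f\in\mathrm{Per}(\mathbb{F}_q^n)\setminus\mathrm{A\Gamma L}(n,\mathbb{F}_q)$. Then \[1\text{-coaffinity}(f)\ge 2q\genfrac{[}{]}{0pt}{0}{n-1}{1}_q=\frac{2q(q^{n-1}-1)}{q-1}.\] Moreover, letting $\tau$ be any transposition of $\mathbb{F}_q^n$, equality holds if and only if $f\in\mathrm{A\Gamma L}(n,\mathbb{F}_q)\circ\tau\circ\mathrm{A\Gamma L}(n,\mathbb{F}_q)$.
   Context: $\mathrm{Per}(\mathbb{F}_q^n)$ is the group of permutations of $\mathbb{F}_q^n$. $\mathrm{A\Gamma L}(n,\mathbb{F}_q)$ is the group of invertible semi-affine maps $x\mapsto g(x)+b$, where $b\in\mathbb{F}_q^n$ and $g$ is a bijective additive map with $g(\alpha x)=\sigma(\alpha)g(x)$ for some automorphism $\sigma$ of $\mathbb{F}_q$. A line is a coset of a $1$-dimensional subspace; $1\text{-coaffinity}(f)$ is the number of lines $L$ with $f(L)$ not a line. A transposition interchanges two distinct points and fixes the rest. *)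

theory Defs
  imports "HOL-Analysis.Analysis" "HOL-Combinatorics.Transposition"
begin

(* F_q^n is the type 'a ^ 'n with 'a a finite field, q = CARD('a) and n = CARD('n).
   Subspaces and dimensions are the 'a-linear ones, vec.subspace and vec.dim; the unqualified
   subspace and dim are those of real vector spaces. *)

definition field_automorphism :: "('a::field \<Rightarrow> 'a) \<Rightarrow> bool" where
  "field_automorphism \<sigma> \<longleftrightarrow>
     bij \<sigma> \<and> \<sigma> 1 = 1 \<and>
     (\<forall>x y. \<sigma> (x + y) = \<sigma> x + \<sigma> y) \<and>
     (\<forall>x y. \<sigma> (x * y) = \<sigma> x * \<sigma> y)"

definition Per :: "('a::field ^ 'n \<Rightarrow> 'a ^ 'n) set" where
  "Per = {f. bij f}"

definition AGammaL :: "('a::field ^ 'n \<Rightarrow> 'a ^ 'n) set" where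
  "AGammaL = {f. \<exists>g b. bij g \<and> (\<forall>x y. g (x + y) = g x + g y) \<and>
       (\<exists>\<sigma>. field_automorphism \<sigma> \<and> (\<forall>\<alpha> x. g (\<alpha> *s x) = \<sigma> \<alpha> *s g x)) \<and>
       f = (\<lambda>x. g x + b)}"

definition is_line :: "('a::field ^ 'n) set \<Rightarrow> bool" where
  "is_line L \<longleftrightarrow> (\<exists>v S. vec.subspace S \<and> vec.dim S = 1 \<and> L = (\<lambda>x. v + x) ` S)"

definition coaffinity1 :: "('a::field ^ 'n \<Rightarrow> 'a ^ 'n) \<Rightarrow> nat" where
  "coaffinity1 f = card {L. is_line L \<and> \<not> is_line (f ` L)}"

definition is_transposition :: "('b \<Rightarrow> 'b) \<Rightarrow> bool" where
  "is_transposition \<tau> \<longleftrightarrow> (\<exists>a b. a \<noteq> b \<and> \<tau> = Transposition.transpose a b)"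

definition gauss_binomial :: "real \<Rightarrow> nat \<Rightarrow> nat \<Rightarrow> real" where
  "gauss_binomial q m k = (\<Prod>i<k. (q ^ (m - i) - 1) / (q ^ (k - i) - 1))"

end

theory Submission
  imports Defs
begin

text \<open>
  Call a line bad if its image under \<open>f\<close> is not a line, and let \<open>T = (q^n - q) / (q - 1)\<close>, so that the
  bound is \<open>2 T\<close> and \<open>T + 1\<close> lines pass through each point. A plane that contains a bad line contains
  at least \<open>q + 1\<close> of them; taking all planes through a bad line, a hyperplane that contains a bad line
  contains at least \<open>(q^(n-1) - 1) / (q - 1)\<close> of them. Hence, if there are at most \<open>2 T\<close> bad lines,
  double counting yields two non-parallel hyperplanes \<open>H\<close> and \<open>H'\<close> without bad lines. By the
  fundamental theorem of affine geometry \<open>f\<close> is semi-affine on each, and the two restrictions glue to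
  some \<open>g\<close> in \<open>AGammaL\<close>. Let \<open>S\<close> be the support of the permutation \<open>g\<inverse> f\<close> and \<open>s = |S|\<close>. Lines
  that meet \<open>S\<close> in exactly one point are bad, which gives at least \<open>s (T + 2 - s)\<close> bad lines; this
  exceeds \<open>2 T\<close> when \<open>2 < s < T\<close>. Lines that join a point of \<open>S\<close> to distinct points of \<open>H\<close> and \<open>H'\<close>
  are almost all bad, which forces \<open>s < T\<close>. So \<open>s = 2\<close>, and \<open>f\<close> is \<open>g\<close> composed with a transposition.
\<close>

subsection \<open>Lines and planes\<close>

text \<open>For \<open>v = 0\<close> this is the single point \<open>p\<close>, so
  \<open>v \<noteq> 0\<close> has to be carried along wherever a genuine line is meant.\<close>

definition aline :: "'a::field ^ 'n \<Rightarrow> 'a ^ 'n \<Rightarrow> ('a ^ 'n) set" where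
  "aline p v = range (\<lambda>t. p + t *s v)"

lemma is_line_iff:
  fixes L :: "('a::field ^ 'n::finite) set"
  shows "is_line L \<longleftrightarrow> (\<exists>p v. v \<noteq> 0 \<and> L = aline p v)"
proof
  assume "is_line L"
  then obtain p S where S: "vec.subspace S" "vec.dim S = 1" and L: "L = (\<lambda>x. p + x) ` S"
    by (auto simp: is_line_def)
  obtain B where B: "B \<subseteq> S" "vec.independent B" "S \<subseteq> vec.span B" "card B = 1"
    using vec.basis_exists[of S] S(2) by metis
  then obtain v where v: "B = {v}" by (auto simp: card_1_singleton_iff)
  then have "v \<noteq> 0" using B(2) vec.dependent_zero by fastforce
  moreover have "S = vec.span {v}"
    using B v S(1) vec.span_minimal[of B S] by auto
  then have "L = aline p v"
    by (auto simp: L aline_def vec.span_singleton)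
  ultimately show "\<exists>p v. v \<noteq> 0 \<and> L = aline p v" by blast
next
  assume "\<exists>p v. v \<noteq> 0 \<and> L = aline p v"
  then obtain p v where "v \<noteq> 0" and L: "L = aline p v" by blast
  have "L = (\<lambda>x. p + x) ` vec.span {v}"
    by (auto simp: L aline_def vec.span_singleton)
  moreover have "vec.dim (vec.span {v}) = 1"
    using \<open>v \<noteq> 0\<close> by (simp add: vec.dim_span vec.dim_eq_card_independent)
  ultimately show "is_line L"
    unfolding is_line_def using vec.subspace_span by blast
qed

lemma start_in_aline [simp]: "p \<in> aline p v"
  unfolding aline_def by (rule image_eqI[of _ _ 0]) auto

lemma end_in_aline [simp]: "y \<in> aline x (y - x)"
  unfolding aline_def by (rule image_eqI[of _ _ 1]) auto

lemma in_aline_iff: "y \<in> aline p v \<longleftrightarrow> (\<exists>t. y = p + t *s v)"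
  by (auto simp: aline_def)

lemma aline_eq_join:
  fixes p :: "'a::field ^ 'n"
  assumes "x \<in> aline p v" "y \<in> aline p v" "x \<noteq> y"
  shows "aline p v = aline x (y - x)"
proof -
  obtain s t where x: "x = p + s *s v" and y: "y = p + t *s v"
    using assms by (auto simp: in_aline_iff)
  have st: "t - s \<noteq> 0" using assms(3) x y by auto
  \<comment> \<open>The affine change of parameter from base point \<open>p\<close> to base point
    \<open>x\<close>; the next fact is its inverse.\<close>
  have 1: "p + r *s v = x + ((r - s) / (t - s)) *s (y - x)" for r
    using st by (simp add: x y vec_eq_iff divide_simps) (simp add: algebra_simps)
  have 2: "x + r *s (y - x) = p + (s + r * (t - s)) *s v" for r
    by (simp add: x y vec_eq_iff algebra_simps)
  show ?thesis
  proof (intro set_eqI iffI)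
    fix z assume "z \<in> aline p v"
    then show "z \<in> aline x (y - x)" unfolding in_aline_iff using 1 by metis
  next
    fix z assume "z \<in> aline x (y - x)"
    then show "z \<in> aline p v" unfolding in_aline_iff using 2 by metis
  qed
qed

lemma is_line_aline: "v \<noteq> 0 \<Longrightarrow> is_line (aline p v :: ('a::field ^ 'n::finite) set)"
  by (auto simp: is_line_iff)

lemma line_eq_join:
  fixes L :: "('a::field ^ 'n::finite) set"
  assumes "is_line L" "x \<in> L" "y \<in> L" "x \<noteq> y"
  shows "L = aline x (y - x)"
  using assms aline_eq_join by (metis is_line_iff)

lemma lines_eqI:
  fixes L :: "('a::field ^ 'n::finite) set"
  assumes "is_line L" "is_line M" "x \<in> L" "y \<in> L" "x \<in> M" "y \<in> M" "x \<noteq> y"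
  shows "L = M"
  using assms line_eq_join by metis

lemma card_aline:
  fixes p :: "'a::{field,finite} ^ 'n"
  assumes "v \<noteq> 0"
  shows "card (aline p v) = CARD('a)"
  unfolding aline_def
  by (intro card_image inj_onI) (use assms in \<open>simp add: vec.scale_right_imp_eq\<close>)

lemma card_line:
  fixes L :: "('a::{field,finite} ^ 'n::finite) set"
  assumes "is_line L"
  shows "card L = CARD('a)"
  using assms card_aline by (metis is_line_iff)

lemma line_subset_eq:
  fixes L :: "('a::{field,finite} ^ 'n::finite) set"
  assumes "is_line L" "is_line M" "L \<subseteq> M"
  shows "L = M"
  using assms by (metis card_line card_subset_eq finite)

text \<open>Closure under joins is all that is wanted of an affine subspace here: a line with two
  points in \<open>A\<close> lies in \<open>A\<close>. The case \<open>x = y\<close> is harmless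
  because \<open>aline x 0\<close> is \<open>{x}\<close>.\<close>

definition flat :: "('a::field ^ 'n) set \<Rightarrow> bool" where
  "flat A \<longleftrightarrow> (\<forall>x\<in>A. \<forall>y\<in>A. aline x (y - x) \<subseteq> A)"

lemma flatD_line:
  fixes L :: "('a::field ^ 'n::finite) set"
  assumes "flat A" "is_line L" "x \<in> L" "y \<in> L" "x \<noteq> y" "x \<in> A" "y \<in> A"
  shows "L \<subseteq> A"
  using assms line_eq_join by (metis flat_def)

text \<open>Degenerates to a line or a point if \<open>v\<close> and \<open>w\<close> are dependent.
  It is flat with at most \<open>q^2\<close> points in every case, so planes spanned by image points
  can be used before their independence is known.\<close>

definition aplane :: "'a::field ^ 'n \<Rightarrow> 'a ^ 'n \<Rightarrow> 'a ^ 'n \<Rightarrow> ('a ^ 'n) set" where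
  "aplane p v w = range (\<lambda>(s, t). p + s *s v + t *s w)"

lemma in_aplane_iff: "y \<in> aplane p v w \<longleftrightarrow> (\<exists>s t. y = p + s *s v + t *s w)"
  by (auto simp: aplane_def)

lemma flat_aplane: "flat (aplane p v w)"
  unfolding flat_def
proof (intro ballI subsetI)
  fix x y z assume "x \<in> aplane p v w" "y \<in> aplane p v w" "z \<in> aline x (y - x)"
  then obtain a b c d t where xy: "x = p + a *s v + b *s w" "y = p + c *s v + d *s w"
    and z: "z = x + t *s (y - x)" unfolding in_aplane_iff in_aline_iff by blast
  have "z = p + (a + t * (c - a)) *s v + (b + t * (d - b)) *s w"
    unfolding z xy by (simp add: vec_eq_iff algebra_simps)
  then show "z \<in> aplane p v w" unfolding in_aplane_iff by blast
qed

lemma card_aplane_le: "card (aplane p v w :: ('a::{field,finite} ^ 'n) set) \<le> CARD('a) ^ 2"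
proof -
  have "card (aplane p v w) \<le> CARD('a \<times> 'a)"
    unfolding aplane_def by (rule card_image_le) simp
  then show ?thesis by (simp add: power2_eq_square)
qed

text \<open>Independence is expressed as \<open>v \<noteq> 0\<close> and \<open>w\<close> not a
  multiple of \<open>v\<close>. With \<open>p = 0\<close> the lemma also serves to compare
  coefficients of two independent vectors.\<close>

lemma aplane_inj:
  fixes p :: "'a::field ^ 'n"
  assumes "v \<noteq> 0" "\<And>t. w \<noteq> t *s v"
    and "p + s *s v + t *s w = p + s' *s v + t' *s w"
  shows "s = s' \<and> t = t'"
proof -
  have e: "(t - t') *s w = (s' - s) *s v"
    using assms(3) by (simp add: vec_eq_iff algebra_simps)
  have "t = t'"
  proof (rule ccontr)
    assume "t \<noteq> t'"
    then have "w = ((s' - s) / (t - t')) *s v"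
      using e by (simp add: vec_eq_iff field_simps)
    then show False using assms(2) by blast
  qed
  then show ?thesis using e assms(1) by auto
qed

lemma card_aplane:
  fixes p :: "'a::{field,finite} ^ 'n"
  assumes "v \<noteq> 0" "\<And>t. w \<noteq> t *s v"
  shows "card (aplane p v w) = CARD('a) ^ 2"
proof -
  have "inj (\<lambda>(s, t). p + s *s v + t *s w)"
    using aplane_inj[OF assms] by (intro injI) auto
  then show ?thesis unfolding aplane_def by (simp add: card_image power2_eq_square)
qed

subsection \<open>Bad lines in a plane\<close>

lemma image_line_subset_flat:
  fixes f :: "'a::field ^ 'n::finite \<Rightarrow> 'a ^ 'n"
  assumes "inj f" "flat A" "is_line (f ` M)" "x \<in> M" "y \<in> M" "x \<noteq> y" "f x \<in> A" "f y \<in> A"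
  shows "f ` M \<subseteq> A"
  using assms flatD_line[of A "f ` M" "f x" "f y"] by (auto simp: inj_eq)

text \<open>Supplies the auxiliary slope or coefficient \<open>m\<close> in the plane argument and
  in the proof of additivity.\<close>

lemma exists_third_element:
  assumes "CARD('a::{field,finite}) \<ge> 3"
  shows "\<exists>m::'a. m \<noteq> 0 \<and> m \<noteq> 1"
proof (rule ccontr)
  assume "\<not> ?thesis"
  then have "UNIV \<subseteq> {0, 1::'a}" by auto
  then have "CARD('a) \<le> card {0, 1::'a}" by (intro card_mono) auto
  then show False using assms by simp
qed

text \<open>Every line of the plane through \<open>p\<close> other than the bad one is good. If
  there were at most \<open>q\<close> bad lines, the images of these good lines would share one
  plane \<open>A\<close>, and neither position of the image of the bad line relative to
  \<open>A\<close> is then possible.\<close>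

lemma bad_lines_in_plane_based:
  fixes f :: "'a::{field,finite} ^ 'n::finite \<Rightarrow> 'a ^ 'n"
  assumes q: "CARD('a) \<ge> 3" and f: "inj f"
    and vw: "v \<noteq> 0" "\<And>t. w \<noteq> t *s v"
    and badL: "\<not> is_line (f ` aline p v)"
    and goodM: "\<And>m. is_line (f ` aline p (m *s v + w))"
  shows "CARD('a) + 1 \<le> card {M. is_line M \<and> M \<subseteq> aplane p v w \<and> \<not> is_line (f ` M)}"
    (is "_ \<le> card ?B")
proof (rule ccontr)
  assume "\<not> ?thesis"
  then have few: "card ?B \<le> CARD('a)" by simp
  \<comment> \<open>In the coordinates \<open>pt\<close> the bad line is \<open>K 0\<close>, the lines \<open>K c\<close> are its parallels, and the \<open>N m 0\<close>
    are the other lines through \<open>p\<close>. The aim is a plane \<open>A\<close> that contains the images of all \<open>N m 0\<close>.\<close>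
  define pt where "pt s t = p + s *s v + t *s w" for s t
  have pt_inj: "pt s t = pt s' t' \<longleftrightarrow> s = s' \<and> t = t'" for s t s' t'
    using aplane_inj[OF vw] unfolding pt_def by blast
  define N where "N m c = aline (p + c *s v) (m *s v + w)" for m c
  define K where "K c = aline (p + c *s w) v" for c
  have N_eq: "N m c = range (\<lambda>t. pt (m * t + c) t)" for m c
  proof -
    have "p + c *s v + t *s (m *s v + w) = pt (m * t + c) t" for t
      by (simp add: pt_def vec_eq_iff algebra_simps)
    then show ?thesis by (simp add: N_def aline_def)
  qed
  have K_eq: "K c = range (\<lambda>s. pt s c)" for c
  proof -
    have "p + c *s w + s *s v = pt s c" for s
      by (simp add: pt_def vec_eq_iff algebra_simps)
    then show ?thesis by (simp add: K_def aline_def)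
  qed
  have N0: "N m 0 = aline p (m *s v + w)" for m by (simp add: N_def)
  have K0: "K 0 = aline p v" by (simp add: K_def)
  have P: "aplane p v w = range (\<lambda>(s, t). pt s t)" by (simp add: aplane_def pt_def)
  have NI: "s = m * t + c \<Longrightarrow> pt s t \<in> N m c" for s t m c by (auto simp: N_eq)
  have KI: "pt s c \<in> K c" for s c by (auto simp: K_eq)
  have "m *s v + w \<noteq> 0" for m
    using vw(2)[of "- m"] by (metis add_eq_0_iff vec.scale_minus_left)
  then have lineN: "is_line (N m c)" for m c unfolding N_def by (rule is_line_aline)
  have lineK: "is_line (K c)" for c unfolding K_def using vw(1) by (rule is_line_aline)
  have subN: "N m c \<subseteq> aplane p v w" and subK: "K c \<subseteq> aplane p v w" for m c
    by (auto simp: N_eq K_eq P)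
  have finB: "finite ?B" by simp
  \<comment> \<open>A good line with two points sent into a flat is sent into it altogether;
    \<open>inN0\<close> is the case where one of the two points is the base point.\<close>
  have incl: "f ` N m c \<subseteq> A"
    if "flat A" "is_line (f ` N m c)" "s = m * t + c" "s' = m * t' + c" "t \<noteq> t'"
      "f (pt s t) \<in> A" "f (pt s' t') \<in> A" for A m c s t s' t'
    using that image_line_subset_flat[OF f that(1,2) NI[of s m t c] NI[of s' m t' c]]
    by (auto simp: pt_inj)
  have goodN0: "is_line (f ` N m 0)" for m using goodM by (simp add: N0)
  have inN0: "f ` N m 0 \<subseteq> A"
    if "flat A" "f (pt 0 0) \<in> A" "s = m * t" "t \<noteq> 0" "f (pt s t) \<in> A" for A m s t
    by (rule incl[of A m 0 0 0 s t]) (use that goodN0 in auto)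
  have "\<exists>A. flat A \<and> card A \<le> CARD('a) ^ 2 \<and> (\<forall>m. f ` N m 0 \<subseteq> A)"
  proof (cases "\<exists>c. c \<noteq> 0 \<and> is_line (f ` K c)")
    case True
    then obtain c where c: "c \<noteq> 0" "is_line (f ` K c)" by blast
    \<comment> \<open>Spanned by the image of \<open>p\<close> and that of the good parallel
      \<open>K c\<close>. Each \<open>N m 0\<close> meets \<open>K c\<close> in a point other than
      \<open>p\<close>, so two of its points go into \<open>A\<close>.\<close>
    define A where "A = aplane (f (pt 0 0)) (f (pt 0 c) - f (pt 0 0)) (f (pt 1 c) - f (pt 0 0))"
    have A: "flat A" "card A \<le> CARD('a) ^ 2"
      unfolding A_def by (rule flat_aplane, rule card_aplane_le)
    have z: "f (pt 0 0) \<in> A" "f (pt 0 c) \<in> A" "f (pt 1 c) \<in> A"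
      unfolding A_def in_aplane_iff
      by (rule exI[of _ 0], rule exI[of _ 0], simp)
         (rule exI[of _ 1], rule exI[of _ 0], simp,
          rule exI[of _ 0], rule exI[of _ 1], simp)
    have "f ` K c \<subseteq> A"
      by (rule image_line_subset_flat[OF f A(1) c(2) KI[of 0] KI[of 1]]) (use z in \<open>auto simp: pt_inj\<close>)
    then have "f (pt s c) \<in> A" for s using KI by blast
    then have "f ` N m 0 \<subseteq> A" for m
      using inN0[OF A(1) z(1) refl c(1)] by blast
    then show ?thesis using A by blast
  next
    case False
    then have badK: "\<not> is_line (f ` K c)" for c using badL K0 by (cases "c = 0") auto
    \<comment> \<open>The parallels already account for \<open>q\<close> bad lines, so they are all
      the bad lines, and every transversal \<open>N m c\<close> is good.\<close>
    have "inj K"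
    proof (rule injI)
      fix c d assume "K c = K d"
      then have "pt 0 c \<in> K d" using KI by blast
      then show "c = d" by (auto simp: K_eq pt_inj)
    qed
    then have "card (range K) = CARD('a)" by (rule card_image)
    moreover have "range K \<subseteq> ?B" using badK lineK subK by auto
    ultimately have B: "?B = range K"
      using few card_seteq[OF finB, of "range K"] by auto
    have goodN: "is_line (f ` N m c)" for m c
    proof (rule ccontr)
      assume "\<not> ?thesis"
      then have "N m c \<in> ?B" using lineN subN by auto
      then obtain d where "N m c = K d" using B by auto
      moreover have "pt c 0 \<in> N m c" "pt (m + c) 1 \<in> N m c" by (auto intro: NI)
      ultimately show False by (auto simp: K_eq pt_inj)
    qed
    \<comment> \<open>Spanned by the image of \<open>p\<close> and that of the good line
      \<open>N 0 1\<close>, where \<open>s = 1\<close>. This line meets \<open>N m 0\<close> for all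
      \<open>m \<noteq> 0\<close>, but is parallel to \<open>N 0 0\<close>.\<close>
    define A where "A = aplane (f (pt 0 0)) (f (pt 1 0) - f (pt 0 0)) (f (pt 1 1) - f (pt 0 0))"
    have A: "flat A" "card A \<le> CARD('a) ^ 2"
      unfolding A_def by (rule flat_aplane, rule card_aplane_le)
    have z: "f (pt 0 0) \<in> A" "f (pt 1 0) \<in> A" "f (pt 1 1) \<in> A"
      unfolding A_def in_aplane_iff
      by (rule exI[of _ 0], rule exI[of _ 0], simp)
         (rule exI[of _ 1], rule exI[of _ 0], simp,
          rule exI[of _ 0], rule exI[of _ 1], simp)
    have "f ` N 0 1 \<subseteq> A"
      by (rule incl[where s = 1 and t = 0 and s' = 1 and t' = 1, OF A(1) goodN]) (use z in auto)
    then have N01: "f (pt 1 t) \<in> A" for t using NI[of 1 0 t 1] by auto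
    have nz: "f ` N m 0 \<subseteq> A" if "m \<noteq> 0" for m
      by (rule inN0[where s = 1 and t = "1 / m", OF A(1) z(1)]) (use that N01 in auto)
    \<comment> \<open>To reach \<open>N 0 0\<close>, use the transversal \<open>N 1 1\<close>. It
      meets \<open>N 0 1\<close> in \<open>pt 1 0\<close> and, since \<open>m \<noteq> 1\<close>, it
      meets \<open>N m 0\<close> as well, so it goes into \<open>A\<close> and takes the point
      \<open>pt 0 (-1)\<close> of \<open>N 0 0\<close> along.\<close>
    obtain m :: 'a where m: "m \<noteq> 0" "m \<noteq> 1" using exists_third_element[OF q] by blast
    have "f (pt (m / (m - 1)) (1 / (m - 1))) \<in> A"
      using nz[OF m(1)] NI[of "m / (m - 1)" m "1 / (m - 1)" 0] by auto
    then have "f ` N 1 1 \<subseteq> A"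
      by (intro incl[where s = 1 and t = 0 and s' = "m / (m - 1)" and t' = "1 / (m - 1)", OF A(1) goodN])
         (use z m in \<open>auto simp: field_simps\<close>)
    then have "f (pt 0 (-1)) \<in> A" using NI[of 0 1 "-1" 1] by auto
    then have "f ` N 0 0 \<subseteq> A"
      by (intro inN0[where s = 0 and t = "-1", OF A(1) z(1)]) auto
    then have "f ` N m 0 \<subseteq> A" for m using nz by (cases "m = 0") auto
    then show ?thesis using A by blast
  qed
  then obtain A where A: "flat A" "card A \<le> CARD('a) ^ 2" "\<And>m. f ` N m 0 \<subseteq> A" by blast
  have onM: "pt s t \<in> N (s / t) 0" if "t \<noteq> 0" for s t using that by (intro NI) auto
  have inA: "f (pt s t) \<in> A" if "t \<noteq> 0" for s t using onM[OF that] A(3) by blast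
  have p: "f (pt 0 0) \<in> A" using A(3)[of 0] NI[of 0 0 0 0] by auto
  show False
  proof (cases "f ` K 0 \<subseteq> A")
    case True
    \<comment> \<open>Then \<open>f\<close> maps the plane onto \<open>A\<close>, and \<open>f ` K 0\<close> is what the other lines through \<open>f p\<close> leave over:
      a line.\<close>
    have K0A: "f (pt s 0) \<in> A" for s using True KI by blast
    have "f ` aplane p v w \<subseteq> A"
    proof (clarsimp simp: P)
      fix s t show "f (pt s t) \<in> A" using K0A inA by (cases "t = 0") auto
    qed
    moreover have "card (f ` aplane p v w) = CARD('a) ^ 2"
      using card_image[OF inj_on_subset[OF f subset_UNIV]] card_aplane[OF vw] by metis
    ultimately have PA: "f ` aplane p v w = A"
      using A(2) by (intro card_seteq) auto
    define l where "l = aline (f (pt 0 0)) (f (pt 1 0) - f (pt 0 0))"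
    have lA: "l \<subseteq> A" using A(1) p K0A unfolding l_def flat_def by blast
    have linel: "is_line l" unfolding l_def
      by (rule is_line_aline) (use f in \<open>auto simp: inj_eq pt_inj\<close>)
    have "l \<subseteq> f ` K 0"
    proof
      fix y assume "y \<in> l"
      then obtain s t where y: "y = f (pt s t)" using lA PA P by auto
      show "y \<in> f ` K 0"
      proof (cases "t = 0")
        case True then show ?thesis using KI y by blast
      next
        case False
        have "l = f ` N (s / t) 0"
        proof (rule lines_eqI[OF linel goodN0])
          show "f (pt 0 0) \<in> l" by (simp add: l_def)
          show "f (pt 0 0) \<in> f ` N (s / t) 0" using NI[of 0 _ 0 0] by auto
          show "y \<in> l" "y \<in> f ` N (s / t) 0" using \<open>y \<in> l\<close> y onM[OF False] by auto
          show "f (pt 0 0) \<noteq> y" using f False by (auto simp: y inj_eq pt_inj)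
        qed
        moreover have "f (pt 1 0) \<in> l" by (simp add: l_def)
        ultimately have "pt 1 0 \<in> N (s / t) 0" using f by (auto simp: inj_eq)
        then show ?thesis by (auto simp: N_eq pt_inj)
      qed
    qed
    moreover have "card (f ` K 0) = card l"
      using card_image[OF inj_on_subset[OF f subset_UNIV]] card_line linel lineK by metis
    ultimately have "l = f ` K 0" by (intro card_seteq) auto
    then show False using linel badL K0 by simp
  next
    case False
    \<comment> \<open>A point of \<open>K 0\<close> is sent outside \<open>A\<close>, and then all \<open>q + 1\<close> lines through it are bad.\<close>
    then obtain c where c: "f (pt c 0) \<notin> A" by (auto simp: K_eq)
    obtain m0 :: 'a where m0: "m0 \<noteq> 0" "m0 \<noteq> 1" using exists_third_element[OF q] by blast
    have badN: "\<not> is_line (f ` N m c)" for m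
    proof
      assume "is_line (f ` N m c)"
      then have "f ` N m c \<subseteq> A"
        by (rule incl[where t = m0 and t' = 1, OF A(1) _ refl refl m0(2)]) (use inA m0 in auto)
      then show False using c NI[of c m 0 c] by auto
    qed
    have "inj (\<lambda>m. N m c)"
    proof (rule injI)
      fix m m' assume "N m c = N m' c"
      then have "pt (m + c) 1 \<in> N m' c" using NI[of "m + c" m 1 c] by auto
      then show "m = m'" by (auto simp: N_eq pt_inj)
    qed
    then have "card (range (\<lambda>m. N m c)) = CARD('a)" by (rule card_image)
    moreover have "K 0 \<notin> range (\<lambda>m. N m c)"
    proof
      assume "K 0 \<in> range (\<lambda>m. N m c)"
      then obtain m where "N m c = K 0" by auto
      moreover have "pt (m + c) 1 \<in> N m c" by (intro NI) auto
      ultimately show False by (auto simp: K_eq pt_inj)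
    qed
    ultimately have "card (insert (K 0) (range (\<lambda>m. N m c))) = CARD('a) + 1" by simp
    moreover have "insert (K 0) (range (\<lambda>m. N m c)) \<subseteq> ?B"
      using lineK[of 0] lineN subK[of 0] subN badN badL unfolding K0[symmetric] by blast
    ultimately show False
      using few card_mono[OF finB, of "insert (K 0) (range (\<lambda>m. N m c))"] by linarith
  qed
qed

text \<open>If each of the \<open>q\<close> points of the bad line is on a second bad line of the
  plane, these second lines are distinct, and with the given one they number \<open>q + 1\<close>.
  Otherwise some point is on no second bad line and can serve as the base point of
  \<open>bad_lines_in_plane_based\<close>.\<close>

lemma bad_lines_in_plane:
  fixes f :: "'a::{field,finite} ^ 'n::finite \<Rightarrow> 'a ^ 'n"
  assumes q: "CARD('a) \<ge> 3" and f: "inj f"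
    and vw: "v \<noteq> 0" "\<And>t. w \<noteq> t *s v"
    and badL: "\<not> is_line (f ` aline p v)"
  shows "CARD('a) + 1 \<le> card {M. is_line M \<and> M \<subseteq> aplane p v w \<and> \<not> is_line (f ` M)}"
    (is "_ \<le> card ?B")
proof (cases "\<forall>x \<in> aline p v. \<exists>M \<in> ?B. M \<noteq> aline p v \<and> x \<in> M")
  case True
  then have "\<forall>x \<in> aline p v. \<exists>M. M \<in> ?B \<and> M \<noteq> aline p v \<and> x \<in> M" by blast
  from bchoice[OF this]
  obtain M where M: "\<And>x. x \<in> aline p v \<Longrightarrow> M x \<in> ?B \<and> M x \<noteq> aline p v \<and> x \<in> M x" by blast
  have "inj_on M (aline p v)"
  proof (rule inj_onI)
    fix x y assume xy: "x \<in> aline p v" "y \<in> aline p v" "M x = M y"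
    show "x = y"
    proof (rule ccontr)
      assume "x \<noteq> y"
      have "y \<in> M x" using M[OF xy(2)] xy(3) by simp
      then have "M x = aline p v"
        using M[OF xy(1)] xy lines_eqI[of "M x" "aline p v" x y] is_line_aline[OF vw(1)] \<open>x \<noteq> y\<close>
        by auto
      then show False using M[OF xy(1)] by simp
    qed
  qed
  then have "card (M ` aline p v) = CARD('a)" using card_aline[OF vw(1)] by (simp add: card_image)
  moreover have "aline p v \<notin> M ` aline p v" using M by auto
  ultimately have "card (insert (aline p v) (M ` aline p v)) = CARD('a) + 1" by simp
  moreover have "aline p v \<subseteq> aplane p v w"
  proof
    fix y assume "y \<in> aline p v"
    then obtain t where "y = p + t *s v + 0 *s w" by (auto simp: in_aline_iff)
    then show "y \<in> aplane p v w" unfolding in_aplane_iff by blast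
  qed
  then have "insert (aline p v) (M ` aline p v) \<subseteq> ?B"
    using M is_line_aline[OF vw(1)] badL by auto
  ultimately show ?thesis
    using card_mono[OF finite[of ?B], of "insert (aline p v) (M ` aline p v)"] by linarith
next
  case False
  then obtain x where x: "x \<in> aline p v"
    and good: "\<And>M. \<lbrakk>M \<in> ?B; x \<in> M\<rbrakk> \<Longrightarrow> M = aline p v" by blast
  then obtain r where r: "x = p + r *s v" by (auto simp: in_aline_iff)
  have plane: "aplane x v w = aplane p v w"
  proof (intro set_eqI iffI)
    fix y assume "y \<in> aplane x v w"
    then obtain s t where "y = x + s *s v + t *s w" by (auto simp: in_aplane_iff)
    then have "y = p + (r + s) *s v + t *s w" by (simp add: r vec_eq_iff algebra_simps)
    then show "y \<in> aplane p v w" unfolding in_aplane_iff by blast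
  next
    fix y assume "y \<in> aplane p v w"
    then obtain s t where "y = p + s *s v + t *s w" by (auto simp: in_aplane_iff)
    then have "y = x + (s - r) *s v + t *s w" by (simp add: r vec_eq_iff algebra_simps)
    then show "y \<in> aplane x v w" unfolding in_aplane_iff by blast
  qed
  have "x + v \<in> aline p v"
    unfolding in_aline_iff by (rule exI[of _ "r + 1"]) (simp add: r vec_eq_iff algebra_simps)
  then have L: "aline x v = aline p v"
    using aline_eq_join[OF x, of "x + v"] vw(1) by auto
  have "is_line (f ` aline x (m *s v + w))" for m
  proof (rule ccontr)
    assume bad: "\<not> ?thesis"
    have nz: "m *s v + w \<noteq> 0"
      using vw(2)[of "- m"] by (metis add_eq_0_iff vec.scale_minus_left)
    have sub: "aline x (m *s v + w) \<subseteq> aplane p v w"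
    proof
      fix y assume "y \<in> aline x (m *s v + w)"
      then obtain t where "y = x + t *s (m *s v + w)" by (auto simp: in_aline_iff)
      then have "y = x + (t * m) *s v + t *s w" by (simp add: vec_eq_iff algebra_simps)
      then show "y \<in> aplane p v w" unfolding plane[symmetric] in_aplane_iff by blast
    qed
    then have "aline x (m *s v + w) = aline x v"
      unfolding L by (intro good) (use bad nz is_line_aline in auto)
    moreover have "x + (m *s v + w) \<in> aline x (m *s v + w)"
      by (metis in_aline_iff vec.scale_one)
    ultimately obtain t where "m *s v + w = t *s v" by (auto simp: in_aline_iff)
    then have "w = (t - m) *s v" by (simp add: vec_eq_iff algebra_simps)
    then show False using vw(2) by blast
  qed
  then show ?thesis
    using bad_lines_in_plane_based[OF q f vw, of x] badL by (simp add: L plane)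
qed

subsection \<open>Bad lines in a hyperplane\<close>

text \<open>Counts the pairs related by \<open>R\<close> in two ways. The factor \<open>r\<close>
  admits a fractional lower bound \<open>m / r\<close> without division.\<close>

lemma double_count:
  fixes R :: "'b \<Rightarrow> 'c \<Rightarrow> bool"
  assumes "finite A" "finite B"
    and lower: "\<And>x. x \<in> A \<Longrightarrow> m \<le> r * card {y \<in> B. R x y}"
    and upper: "\<And>y. y \<in> B \<Longrightarrow> card {x \<in> A. R x y} \<le> k"
  shows "m * card A \<le> r * k * card B"
proof -
  have "m * card A = (\<Sum>x\<in>A. m)" by simp
  also have "\<dots> \<le> (\<Sum>x\<in>A. r * card {y \<in> B. R x y})"
    using lower by (rule sum_mono)
  also have "\<dots> = r * (\<Sum>y\<in>B. card {x \<in> A. R x y})"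
    unfolding sum_distrib_left[symmetric]
    using sum_multicount_gen[OF assms(1,2), of R "\<lambda>y. card {x \<in> A. R x y}"] by simp
  also have "\<dots> \<le> r * (\<Sum>y\<in>B. k)"
    using upper by (intro mult_left_mono sum_mono) auto
  also have "\<dots> = r * k * card B" by simp
  finally show ?thesis .
qed

section \<open>Linear forms and hyperplanes over a finite field\<close>

definition dotp :: "'a::comm_ring_1 ^ 'n::finite \<Rightarrow> 'a ^ 'n \<Rightarrow> 'a" where
  "dotp a x = (\<Sum>i\<in>UNIV. a $ i * x $ i)"

lemma dotp_simps [simp]:
  "dotp a (x + y) = dotp a x + dotp a y"
  "dotp a (x - y) = dotp a x - dotp a y"
  "dotp a (- x) = - dotp a x"
  "dotp a (t *s x) = t * dotp a x"
  "dotp a 0 = 0"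
  by (simp_all add: dotp_def sum.distrib sum_subtractf sum_negf sum_distrib_left algebra_simps)

lemma dotp_commute: "dotp a x = dotp x a"
  by (simp add: dotp_def mult.commute)

lemma dotp_axis: "dotp a (axis i 1) = a $ i"
proof -
  have "dotp a (axis i 1) = (\<Sum>j\<in>UNIV. if j = i then a $ j else 0)"
    unfolding dotp_def by (intro sum.cong) (auto simp: axis_def)
  then show ?thesis by simp
qed

lemma exists_dotp_nonzero:
  fixes a :: "'a::comm_ring_1 ^ 'n::finite"
  assumes "a \<noteq> 0"
  shows "\<exists>u. dotp a u \<noteq> 0"
  using assms by (metis dotp_axis vec_eq_iff zero_index)

text \<open>If \<open>b\<close> vanished on the kernel of \<open>a\<close>, it would vanish on the
  vectors \<open>a $ i *s axis j 1 - a $ j *s axis i 1\<close>, and a nonzero coordinate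
  \<open>a $ i\<close> then makes \<open>b\<close> a multiple of \<open>a\<close>.\<close>

lemma exists_in_kernel_dotp_nonzero:
  fixes a b :: "'a::field ^ 'n::finite"
  assumes "a \<noteq> 0" "\<And>t. b \<noteq> t *s a"
  shows "\<exists>u. dotp a u = 0 \<and> dotp b u \<noteq> 0"
proof (rule ccontr)
  assume no: "\<not> ?thesis"
  obtain i where i: "a $ i \<noteq> 0" using assms(1) by (auto simp: vec_eq_iff)
  have eq: "b $ j = (b $ i / a $ i) * a $ j" for j
  proof -
    have "dotp a (a $ i *s axis j 1 - a $ j *s axis i 1) = 0"
      by (simp add: dotp_axis)
    then have "dotp b (a $ i *s axis j 1 - a $ j *s axis i 1) = 0" using no by blast
    then have "a $ i * b $ j = a $ j * b $ i" by (simp add: dotp_axis)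
    then show ?thesis using i by (simp add: field_simps)
  qed
  have "b = (b $ i / a $ i) *s a"
    unfolding vec_eq_iff vector_smult_component by (intro allI eq)
  then show False using assms(2) by blast
qed

text \<open>Moving along a vector \<open>e\<close> of \<open>W\<close> on which the form is 1
  identifies the product of one fibre with the field with \<open>W\<close>.\<close>

lemma card_subspace_fibre:
  fixes a :: "'a::{field,finite} ^ 'n::finite"
  assumes W: "vec.subspace W" and u: "u \<in> W" "dotp a u \<noteq> 0"
  shows "card {x \<in> W. dotp a x = c} * CARD('a) = card W"
proof -
  define e where "e = (1 / dotp a u) *s u"
  have e: "e \<in> W" "dotp a e = 1"
    using assms vec.subspace_scale[OF W] by (auto simp: e_def)
  have "bij_betw (\<lambda>(x, t). x + t *s e) ({x \<in> W. dotp a x = c} \<times> UNIV) W"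
    by (rule bij_betw_byWitness[where f' = "\<lambda>y. (y - (dotp a y - c) *s e, dotp a y - c)"])
       (use e W in \<open>auto simp: vec.subspace_add vec.subspace_diff vec.subspace_scale\<close>)
  from bij_betw_same_card[OF this] show ?thesis by (simp add: card_cartesian_product)
qed

text \<open>A hyperplane if \<open>a \<noteq> 0\<close>. The pairs \<open>(a, c)\<close> and
  \<open>(t *s a, t * c)\<close> with \<open>t \<noteq> 0\<close> give the same set, so counting
  pairs counts every hyperplane \<open>q - 1\<close> times.\<close>

abbreviation hplane :: "'a::comm_ring_1 ^ 'n::finite \<Rightarrow> 'a \<Rightarrow> ('a ^ 'n) set" where
  "hplane a c \<equiv> {x. dotp a x = c}"

lemma subspace_kernel: "vec.subspace (hplane a 0)"
  by (auto simp: vec.subspace_def)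

lemma card_hplane:
  fixes a :: "'a::{field,finite} ^ 'n::finite"
  assumes "a \<noteq> 0"
  shows "card (hplane a c) = CARD('a) ^ (CARD('n) - 1)"
proof -
  obtain u where u: "dotp a u \<noteq> 0" using exists_dotp_nonzero[OF assms] by blast
  have "card {x \<in> UNIV. dotp a x = c} * CARD('a) = CARD('a ^ 'n)"
    by (rule card_subspace_fibre[OF vec.subspace_UNIV UNIV_I u])
  also have "\<dots> = CARD('a) ^ (CARD('n) - 1) * CARD('a)"
    unfolding CARD_vec by (rule power_minus_mult[symmetric]) simp
  finally show ?thesis by simp
qed

text \<open>A translation turns the intersection into a fibre of \<open>dotp b\<close> on the kernel
  of \<open>a\<close>, on which \<open>dotp b\<close> does not vanish.\<close>

lemma card_hplane_Int:
  fixes a b :: "'a::{field,finite} ^ 'n::finite"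
  assumes "a \<noteq> 0" "\<And>t. b \<noteq> t *s a" "CARD('n) \<ge> 2"
  shows "card {x. dotp a x = c \<and> dotp b x = d} = CARD('a) ^ (CARD('n) - 2)"
proof -
  obtain u where u: "dotp a u = 0" "dotp b u \<noteq> 0"
    using exists_in_kernel_dotp_nonzero[OF assms(1,2)] by blast
  obtain v where v: "dotp a v \<noteq> 0" using exists_dotp_nonzero[OF assms(1)] by blast
  define p where "p = (c / dotp a v) *s v"
  have p: "dotp a p = c" using v by (simp add: p_def)
  have "bij_betw (\<lambda>x. p + x) {x \<in> hplane a 0. dotp b x = d - dotp b p} {x. dotp a x = c \<and> dotp b x = d}"
    by (rule bij_betw_byWitness[where f' = "\<lambda>x. x - p"]) (auto simp: p)
  then have "card {x. dotp a x = c \<and> dotp b x = d} = card {x \<in> hplane a 0. dotp b x = d - dotp b p}"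
    by (rule bij_betw_same_card[symmetric])
  moreover have "card {x \<in> hplane a 0. dotp b x = d - dotp b p} * CARD('a) = card (hplane a 0)"
    using u by (intro card_subspace_fibre[OF subspace_kernel]) auto
  moreover have "CARD('n) - 1 = Suc (CARD('n) - 2)" using assms(3) by simp
  then have "card (hplane a 0) = CARD('a) ^ (CARD('n) - 2) * CARD('a)"
    unfolding card_hplane[OF assms(1)] by simp
  ultimately show ?thesis by simp
qed

lemma aline_subset_hplane_iff:
  fixes a :: "'a::field ^ 'n::finite"
  shows "aline p v \<subseteq> hplane a c \<longleftrightarrow> dotp a p = c \<and> dotp a v = 0"
proof
  assume *: "aline p v \<subseteq> hplane a c"
  have "p \<in> aline p v" "p + 1 *s v \<in> aline p v" by (simp, unfold in_aline_iff) blast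
  then have "dotp a p = c" "dotp a (p + 1 *s v) = c" using * by blast+
  then show "dotp a p = c \<and> dotp a v = 0" by simp
qed (auto simp: in_aline_iff)

section \<open>Bad lines and the hyperplanes that contain them\<close>

abbreviation bad_lines :: "('a::field ^ 'n::finite \<Rightarrow> 'a ^ 'n) \<Rightarrow> ('a ^ 'n) set set" where
  "bad_lines f \<equiv> {L. is_line L \<and> \<not> is_line (f ` L)}"

text \<open>Counts pairs of a direction \<open>w\<close> of the hyperplane off \<open>L\<close> and
  a bad line other than \<open>L\<close> in the plane spanned by \<open>L\<close> and
  \<open>w\<close>. Each plane contributes at least \<open>q\<close> such lines, and each line
  determines its plane, hence \<open>w\<close> up to \<open>q * (q - 1)\<close> choices.\<close>

lemma bad_lines_in_hplane:
  fixes f :: "'a::{field,finite} ^ 'n::finite \<Rightarrow> 'a ^ 'n"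
  assumes q: "CARD('a) \<ge> 3" and f: "inj f" and a: "a \<noteq> 0"
    and L: "L \<in> bad_lines f" "L \<subseteq> hplane a c"
  shows "CARD('a) ^ (CARD('n) - 1) - 1 \<le> (CARD('a) - 1) * card {M \<in> bad_lines f. M \<subseteq> hplane a c}"
    (is "_ \<le> _ * card ?B")
proof -
  let ?q = "CARD('a)"
  obtain p v where v: "v \<noteq> 0" and Lpv: "L = aline p v" using L(1) by (auto simp: is_line_iff)
  have dp: "dotp a p = c" "dotp a v = 0" using L(2) unfolding Lpv aline_subset_hplane_iff by auto
  define W where "W = hplane a 0 - aline 0 v"
  have "aline 0 v \<subseteq> hplane a 0" using dp(2) by (simp add: aline_subset_hplane_iff)
  then have cardW: "card W = ?q ^ (CARD('n) - 1) - ?q"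
    unfolding W_def by (simp add: card_Diff_subset card_hplane[OF a] card_aline[OF v])
  have "?q * card W \<le> 1 * (?q * (?q - 1)) * card (?B - {L})"
  proof (rule double_count[where R = "\<lambda>w M. M \<subseteq> aplane p v w"])
    fix w assume w: "w \<in> W"
    have "\<And>t. w \<noteq> t *s v" using w by (auto simp: W_def in_aline_iff)
    then have "?q + 1 \<le> card {M. is_line M \<and> M \<subseteq> aplane p v w \<and> \<not> is_line (f ` M)}"
      using L(1) by (intro bad_lines_in_plane[OF q f v]) (auto simp: Lpv)
    also have "\<dots> \<le> card (insert L {M \<in> ?B - {L}. M \<subseteq> aplane p v w})"
    proof (rule card_mono)
      have "aplane p v w \<subseteq> hplane a c"
        using w dp by (auto simp: aplane_def W_def)
      then show "{M. is_line M \<and> M \<subseteq> aplane p v w \<and> \<not> is_line (f ` M)}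
          \<subseteq> insert L {M \<in> ?B - {L}. M \<subseteq> aplane p v w}" by auto
    qed simp
    also have "\<dots> \<le> Suc (card {M \<in> ?B - {L}. M \<subseteq> aplane p v w})" by (rule card_insert_le_m1) auto
    finally show "?q \<le> 1 * card {M \<in> ?B - {L}. M \<subseteq> aplane p v w}" by simp
  next
    fix M assume M: "M \<in> ?B - {L}"
    then have "\<not> M \<subseteq> L" using line_subset_eq[of M L] L(1) by auto
    then obtain y where y: "y \<in> M" "y \<notin> L" by blast
    \<comment> \<open>The point \<open>y\<close> of \<open>M\<close> off \<open>L\<close> fixes the
      plane; solving for \<open>w\<close> gives a combination of \<open>v\<close> and
      \<open>y - p\<close> whose second coefficient is not 0.\<close>
    have "{w \<in> W. M \<subseteq> aplane p v w} \<subseteq> (\<lambda>(s, t). s *s v + t *s (y - p)) ` (UNIV \<times> (UNIV - {0}))"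
    proof
      fix w assume w: "w \<in> {w \<in> W. M \<subseteq> aplane p v w}"
      then have "y \<in> aplane p v w" using y by blast
      then obtain s t where st: "y = p + s *s v + t *s w" unfolding in_aplane_iff by blast
      have t: "t \<noteq> 0" using st y by (auto simp: Lpv in_aline_iff)
      then have "w = (- s / t) *s v + (1 / t) *s (y - p)"
        by (simp add: st vec_eq_iff field_simps)
      then show "w \<in> (\<lambda>(s, t). s *s v + t *s (y - p)) ` (UNIV \<times> (UNIV - {0}))"
        using t by (intro image_eqI[of _ _ "(- s / t, 1 / t)"]) auto
    qed
    then have "card {w \<in> W. M \<subseteq> aplane p v w}
        \<le> card ((\<lambda>(s, t). s *s v + t *s (y - p)) ` (UNIV \<times> (UNIV - {0::'a})))"
      by (intro card_mono) auto
    also have "\<dots> \<le> card (UNIV \<times> (UNIV - {0::'a}) :: ('a \<times> 'a) set)" by (rule card_image_le) simp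
    also have "\<dots> = ?q * (?q - 1)" by (simp add: card_cartesian_product card_Diff_singleton)
    finally show "card {w \<in> W. M \<subseteq> aplane p v w} \<le> ?q * (?q - 1)" .
  qed auto
  then have "card W \<le> (?q - 1) * card (?B - {L})" using q by simp
  \<comment> \<open>Counting \<open>L\<close> itself adds \<open>q - 1\<close> on the right, which
    turns \<open>q^(n-1) - q\<close> into \<open>q^(n-1) - 1\<close>.\<close>
  moreover have "card ?B = Suc (card (?B - {L}))"
    using L by (intro card.remove) auto
  then have "(?q - 1) * card ?B = (?q - 1) + (?q - 1) * card (?B - {L})" by (simp only: mult_Suc_right)
  ultimately show ?thesis unfolding cardW using q by linarith
qed

text \<open>Let \<open>X\<close> be the set of pairs \<open>(a, c)\<close> whose hyperplane contains
  a bad line. Double counting against the bad lines bounds \<open>X\<close> by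
  \<open>2 * (q^n - q)\<close>, while there are \<open>(q^n - 1) * q\<close> pairs in all; the
  surplus exceeds \<open>q^2\<close>, enough for a second pair with another normal
  direction.\<close>

lemma two_good_hplanes:
  fixes f :: "'a::{field,finite} ^ 'n::finite \<Rightarrow> 'a ^ 'n"
  assumes q: "CARD('a) \<ge> 3" and n: "CARD('n) \<ge> 3" and f: "inj f"
    and few: "(CARD('a) - 1) * card (bad_lines f) \<le> 2 * (CARD('a) ^ CARD('n) - CARD('a))"
  obtains a b c d where "a \<noteq> 0" "\<And>t. b \<noteq> t *s a"
    "\<And>L. is_line L \<Longrightarrow> L \<subseteq> hplane a c \<Longrightarrow> is_line (f ` L)"
    "\<And>L. is_line L \<Longrightarrow> L \<subseteq> hplane b d \<Longrightarrow> is_line (f ` L)"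
proof -
  let ?q = "CARD('a)" and ?n = "CARD('n)"
  define X where "X = {(a, c). a \<noteq> 0 \<and> (\<exists>L \<in> bad_lines f. L \<subseteq> hplane a c)}"
  define Y where "Y = {a :: 'a ^ 'n. a \<noteq> 0} \<times> (UNIV :: 'a set)"
  let ?k = "?q ^ (?n - 1) - 1"
  have kpos: "?k > 0"
  proof -
    have "?q ^ 1 \<le> ?q ^ (?n - 1)" using n q by (intro power_increasing) auto
    then show ?thesis using q by simp
  qed
  have "?k * card X \<le> (?q - 1) * ?k * card (bad_lines f)"
  proof (rule double_count[where R = "\<lambda>(a, c) M. M \<subseteq> hplane a c"])
    fix x assume "x \<in> X"
    then obtain a c L where x: "x = (a, c)" "a \<noteq> 0" "L \<in> bad_lines f" "L \<subseteq> hplane a c"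
      by (auto simp: X_def)
    then show "?k \<le> (?q - 1) * card {y \<in> bad_lines f. (case x of (a, c) \<Rightarrow> \<lambda>M. M \<subseteq> hplane a c) y}"
      using bad_lines_in_hplane[OF q f x(2-4)] by simp
  next
    fix M assume "M \<in> bad_lines f"
    then obtain p v where v: "v \<noteq> 0" and M: "M = aline p v" by (auto simp: is_line_iff)
    \<comment> \<open>A hyperplane contains \<open>aline p v\<close> only if its normal is
      orthogonal to \<open>v\<close>, and then \<open>c\<close> is determined by
      \<open>p\<close>.\<close>
    have "{x \<in> X. (case x of (a, c) \<Rightarrow> \<lambda>M. M \<subseteq> hplane a c) M}
      \<subseteq> (\<lambda>a. (a, dotp a p)) ` (hplane v 0 - {0})"
      by (auto simp: X_def M aline_subset_hplane_iff dotp_commute)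
    then have "card {x \<in> X. (case x of (a, c) \<Rightarrow> \<lambda>M. M \<subseteq> hplane a c) M}
        \<le> card ((\<lambda>a. (a, dotp a p)) ` (hplane v 0 - {0}))" by (intro card_mono) auto
    also have "\<dots> \<le> card (hplane v 0 - {0})" by (rule card_image_le) simp
    also have "\<dots> = ?k" by (simp add: card_Diff_singleton card_hplane[OF v])
    finally show "card {x \<in> X. (case x of (a, c) \<Rightarrow> \<lambda>M. M \<subseteq> hplane a c) M} \<le> ?k" .
  qed auto
  then have "?k * card X \<le> ?k * ((?q - 1) * card (bad_lines f))" by (simp add: ac_simps)
  then have "card X \<le> (?q - 1) * card (bad_lines f)" using kpos by simp
  then have cX: "card X \<le> 2 * (?q ^ ?n - ?q)" using few by simp
  have cY: "card Y = (?q ^ ?n - 1) * ?q"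
  proof -
    have "{a :: 'a ^ 'n. a \<noteq> 0} = UNIV - {0}" by auto
    then show ?thesis unfolding Y_def by (simp add: card_cartesian_product card_Diff_singleton CARD_vec)
  qed
  have big: "card X + ?q ^ 2 < card Y"
  proof -
    have "?q ^ 3 \<le> ?q ^ ?n" using n q by (intro power_increasing) auto
    moreover have "?q ^ 2 < ?q ^ 3" using q by (intro power_strict_increasing) auto
    moreover have "?q ^ ?n * 3 \<le> ?q ^ ?n * ?q" using q by simp
    moreover have "(?q ^ ?n - 1) * ?q = ?q ^ ?n * ?q - ?q" by (simp add: diff_mult_distrib)
    moreover have "?q < ?q ^ 2" using q by (simp add: power2_eq_square)
    ultimately show ?thesis using cX unfolding cY by linarith
  qed
  have "\<not> Y \<subseteq> X" using big card_mono[of X Y] by auto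
  then obtain a c where ac: "(a, c) \<in> Y - X" by auto
  \<comment> \<open>All pairs whose normal is a multiple of \<open>a\<close>; the second pair must
    avoid them.\<close>
  define Z where "Z = range (\<lambda>(t, d). (t *s a, d :: 'a))"
  have "card Z \<le> CARD('a \<times> 'a)" unfolding Z_def by (rule card_image_le) simp
  then have "card Z \<le> ?q ^ 2" by (simp add: power2_eq_square)
  then have "card (X \<union> Z) < card Y" using card_Un_le[of X Z] big by linarith
  then have "\<not> Y \<subseteq> X \<union> Z" using card_mono[of "X \<union> Z" Y] by auto
  then obtain b d where bd: "(b, d) \<in> Y - X" "(b, d) \<notin> Z" by auto
  show thesis
  proof (rule that)
    show "a \<noteq> 0" using ac by (auto simp: Y_def)
    show "b \<noteq> t *s a" for t using bd(2) by (auto simp: Z_def)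
    show "is_line (f ` L)" if "is_line L" "L \<subseteq> hplane a c" for L
      using that ac by (auto simp: X_def Y_def)
    show "is_line (f ` L)" if "is_line L" "L \<subseteq> hplane b d" for L
      using that bd(1) by (auto simp: X_def Y_def)
  qed
qed

subsection \<open>Semi-affine maps\<close>

lemma field_automorphism_comp:
  "field_automorphism \<sigma> \<Longrightarrow> field_automorphism \<tau> \<Longrightarrow> field_automorphism (\<sigma> \<circ> \<tau>)"
  by (auto simp: field_automorphism_def bij_comp)

lemma field_automorphism_inv:
  assumes "field_automorphism \<sigma>"
  shows "field_automorphism (inv \<sigma>)"
proof -
  have b: "bij \<sigma>" and s: "\<sigma> 1 = 1" "\<And>x y. \<sigma> (x + y) = \<sigma> x + \<sigma> y" "\<And>x y. \<sigma> (x * y) = \<sigma> x * \<sigma> y"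
    using assms by (auto simp: field_automorphism_def)
  have r: "\<sigma> (inv \<sigma> x) = x" for x using b by (simp add: bij_is_surj surj_f_inv_f)
  have i: "\<sigma> x = \<sigma> y \<Longrightarrow> x = y" for x y using b by (simp add: bij_is_inj inj_eq)
  have "inv \<sigma> 1 = 1" "inv \<sigma> (x + y) = inv \<sigma> x + inv \<sigma> y" "inv \<sigma> (x * y) = inv \<sigma> x * inv \<sigma> y" for x y
    by (rule i, simp add: r s)+
  then show ?thesis using b by (simp add: field_automorphism_def bij_imp_bij_inv)
qed

lemma AGammaLI:
  assumes "bij g" "\<And>x y. g (x + y) = g x + g y" "field_automorphism \<sigma>"
    "\<And>\<alpha> x. g (\<alpha> *s x) = \<sigma> \<alpha> *s g x"
  shows "(\<lambda>x. g x + b) \<in> AGammaL"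
  unfolding AGammaL_def using assms by blast

lemma AGammaLE:
  assumes "f \<in> AGammaL"
  obtains g b \<sigma> where "bij g" "\<And>x y. g (x + y) = g x + g y" "field_automorphism \<sigma>"
    "\<And>\<alpha> x. g (\<alpha> *s x) = \<sigma> \<alpha> *s g x" "f = (\<lambda>x. g x + b)"
  using assms unfolding AGammaL_def by blast

lemma bij_AGammaL:
  fixes f :: "'a::field ^ 'n \<Rightarrow> 'a ^ 'n"
  assumes "f \<in> AGammaL"
  shows "bij f"
proof -
  obtain g b where "bij g" and f: "f = (\<lambda>x. g x + b)" using assms by (rule AGammaLE)
  moreover have "f = (\<lambda>x. x + b) \<circ> g" by (auto simp: f)
  moreover have "bij (\<lambda>x. x + b)" by (rule bij_plus_right)
  ultimately show ?thesis by (metis bij_comp)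
qed

lemma AGammaL_comp:
  assumes "f \<in> AGammaL" "h \<in> AGammaL"
  shows "f \<circ> h \<in> AGammaL"
proof -
  obtain g b \<sigma> where 1: "bij g" "\<And>x y. g (x + y) = g x + g y" "field_automorphism \<sigma>"
    "\<And>\<alpha> x. g (\<alpha> *s x) = \<sigma> \<alpha> *s g x" "f = (\<lambda>x. g x + b)" using assms(1) by (rule AGammaLE) blast
  obtain g' b' \<sigma>' where 2: "bij g'" "\<And>x y. g' (x + y) = g' x + g' y" "field_automorphism \<sigma>'"
    "\<And>\<alpha> x. g' (\<alpha> *s x) = \<sigma>' \<alpha> *s g' x" "h = (\<lambda>x. g' x + b')" using assms(2) by (rule AGammaLE) blast
  have "(\<lambda>x. (g \<circ> g') x + (g b' + b)) \<in> AGammaL"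
    by (rule AGammaLI[OF bij_comp[OF 2(1) 1(1)] _ field_automorphism_comp[OF 1(3) 2(3)]])
       (simp_all add: 1 2)
  moreover have "f \<circ> h = (\<lambda>x. (g \<circ> g') x + (g b' + b))" by (auto simp: 1 2 add.assoc)
  ultimately show ?thesis by simp
qed

lemma AGammaL_inv:
  assumes "f \<in> AGammaL"
  shows "inv f \<in> AGammaL"
proof -
  obtain g b \<sigma> where g: "bij g" "\<And>x y. g (x + y) = g x + g y" "field_automorphism \<sigma>"
    "\<And>\<alpha> x. g (\<alpha> *s x) = \<sigma> \<alpha> *s g x" and f: "f = (\<lambda>x. g x + b)" using assms by (rule AGammaLE) blast
  have r: "g (inv g x) = x" for x using g(1) by (simp add: bij_is_surj surj_f_inv_f)
  have i: "g x = g y \<Longrightarrow> x = y" for x y using g(1) by (simp add: bij_is_inj inj_eq)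
  have s: "\<sigma> (inv \<sigma> x) = x" for x
    using g(3) by (simp add: field_automorphism_def bij_is_surj surj_f_inv_f)
  have add: "inv g (x + y) = inv g x + inv g y" for x y by (rule i) (simp add: r g)
  have sm: "inv g (\<alpha> *s x) = inv \<sigma> \<alpha> *s inv g x" for \<alpha> x by (rule i) (simp add: r g s)
  have "(\<lambda>x. inv g x + inv g (- b)) \<in> AGammaL"
    by (rule AGammaLI[OF bij_imp_bij_inv[OF g(1)] add field_automorphism_inv[OF g(3)] sm])
  moreover have "inv f = (\<lambda>x. inv g x + inv g (- b))"
    by (rule inv_equality) (auto simp: f g(2) r add[symmetric] bij_is_inj[OF g(1)])
  ultimately show ?thesis by simp
qed

lemma translation_AGammaL: "(\<lambda>x. x + b) \<in> AGammaL"
  by (rule AGammaLI[of "\<lambda>x. x" "\<lambda>x. x"]) (auto simp: field_automorphism_def bij_id[unfolded id_def])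

lemma is_line_image_AGammaL:
  fixes f :: "'a::field ^ 'n::finite \<Rightarrow> 'a ^ 'n"
  assumes "f \<in> AGammaL" "is_line L"
  shows "is_line (f ` L)"
proof -
  obtain g b \<sigma> where g: "bij g" "\<And>x y. g (x + y) = g x + g y" "field_automorphism \<sigma>"
    "\<And>\<alpha> x. g (\<alpha> *s x) = \<sigma> \<alpha> *s g x" and f: "f = (\<lambda>x. g x + b)" using assms(1) by (rule AGammaLE) blast
  obtain p v where v: "v \<noteq> 0" "L = aline p v" using assms(2) by (auto simp: is_line_iff)
  have "g 0 = 0" using g(2)[of 0 0] by simp
  then have "g v \<noteq> 0" using v(1) g(1) by (metis bij_is_inj inj_eq)
  moreover have "f ` L = aline (f p) (g v)"
  proof -
    have "f ` L = range ((\<lambda>t. f p + t *s g v) \<circ> \<sigma>)"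
      by (auto simp: v aline_def f g image_comp algebra_simps)
    also have "\<dots> = aline (f p) (g v)"
      using g(3) unfolding aline_def image_comp[symmetric] field_automorphism_def
      by (metis bij_is_surj)
    finally show ?thesis .
  qed
  ultimately show ?thesis by (auto simp: is_line_iff)
qed

lemma is_line_image_AGammaL_iff:
  fixes f :: "'a::field ^ 'n::finite \<Rightarrow> 'a ^ 'n"
  assumes "f \<in> AGammaL"
  shows "is_line (f ` L) \<longleftrightarrow> is_line L"
proof
  assume "is_line (f ` L)"
  then have "is_line (inv f ` f ` L)"
    by (rule is_line_image_AGammaL[OF AGammaL_inv[OF assms]])
  then show "is_line L"
    using bij_AGammaL[OF assms] by (simp add: image_comp bij_is_inj)
qed (rule is_line_image_AGammaL[OF assms])

text \<open>The fundamental theorem of affine geometry for a subspace \<open>V\<close>. The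
  assumption \<open>dim2\<close> says that \<open>V\<close> has dimension at least 2, in the form in
  which auxiliary vectors are drawn from it. Additivity comes first for independent vectors, then in
  general; the automorphism is read off one vector and transferred to the others.\<close>

lemma semilinear_on_subspace:
  fixes f :: "'a::{field,finite} ^ 'n::finite \<Rightarrow> 'a ^ 'n"
  assumes q: "CARD('a) \<ge> 3" and f: "inj f" and f0: "f 0 = 0"
    and V: "vec.subspace V" and dim2: "\<And>x. x \<in> V \<Longrightarrow> \<exists>w\<in>V. \<forall>t. w \<noteq> t *s x"
    and good: "\<And>L. is_line L \<Longrightarrow> L \<subseteq> V \<Longrightarrow> is_line (f ` L)"
  shows "\<exists>\<sigma>. field_automorphism \<sigma> \<and> (\<forall>\<alpha>. \<forall>x\<in>V. f (\<alpha> *s x) = \<sigma> \<alpha> *s f x) \<and>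
    (\<forall>x\<in>V. \<forall>y\<in>V. f (x + y) = f x + f y)"
proof -
  note Vs = vec.subspace_add[OF V] vec.subspace_scale[OF V] vec.subspace_diff[OF V]
  define ind where "ind x y \<longleftrightarrow> x \<noteq> 0 \<and> (\<forall>t. y \<noteq> t *s x)" for x y :: "'a ^ 'n"
  have ind_sym: "ind y x" if "ind x y" for x y
  proof -
    have "y \<noteq> 0" using that by (metis ind_def vec.scale_zero_left)
    moreover have "x \<noteq> t *s y" for t
    proof
      assume x: "x = t *s y"
      then have "t \<noteq> 0" using that by (auto simp: ind_def)
      then have "y = (1 / t) *s x" by (simp add: x)
      then show False using that by (auto simp: ind_def)
    qed
    ultimately show ?thesis by (auto simp: ind_def)
  qed
  have fnz: "f x \<noteq> 0" if "x \<noteq> 0" for x using that f f0 by (metis inj_eq)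
  have sub: "aline p v \<subseteq> V" if "p \<in> V" "v \<in> V" for p v
    using that Vs by (auto simp: in_aline_iff)
  have ray: "f ` aline 0 x = aline 0 (f x)" if "x \<in> V" "x \<noteq> 0" for x
  proof -
    have "is_line (f ` aline 0 x)"
      by (rule good[OF is_line_aline[OF that(2)] sub]) (use that V in \<open>auto simp: vec.subspace_0\<close>)
    moreover have "0 \<in> f ` aline 0 x" using f0 by (metis image_eqI start_in_aline)
    moreover have "f x \<in> f ` aline 0 x" using end_in_aline[of x 0] by simp
    ultimately show ?thesis using line_eq_join[of "f ` aline 0 x" 0 "f x"] fnz[OF that(2)] by simp
  qed
  have fscale: "\<exists>s. f (t *s x) = s *s f x" if "x \<in> V" "x \<noteq> 0" for x t
  proof -
    have "t *s x \<in> aline 0 x" by (auto simp: in_aline_iff)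
    then have "f (t *s x) \<in> aline 0 (f x)" using ray[OF that] by blast
    then show ?thesis by (simp add: in_aline_iff)
  qed
  have scalef: "\<exists>t. s *s f x = f (t *s x)" if "x \<in> V" "x \<noteq> 0" for x s
  proof -
    have "s *s f x \<in> aline 0 (f x)" by (auto simp: in_aline_iff)
    then have "s *s f x \<in> f ` aline 0 x" using ray[OF that] by blast
    then show ?thesis by (auto simp: in_aline_iff)
  qed
  have find: "ind (f x) (f y)" if xy: "x \<in> V" "ind x y" for x y
  proof -
    have x0: "x \<noteq> 0" using xy by (simp add: ind_def)
    have "f y \<noteq> t *s f x" for t
      using scalef[OF xy(1) x0, of t] f xy(2) by (metis ind_def inj_eq)
    then show ?thesis using fnz[OF x0] by (simp add: ind_def)
  qed
  have half: "\<exists>s. f (x + y) = f x + s *s f y" if xy: "x \<in> V" "y \<in> V" "ind x y" for x y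
  proof -
    have x0: "x \<noteq> 0" and y0: "y \<noteq> 0" using xy(3) ind_sym[OF xy(3)] by (auto simp: ind_def)
    obtain m :: 'a where m: "m \<noteq> 0" "m \<noteq> 1" using exists_third_element[OF q] by blast
    \<comment> \<open>Chosen so that the line joining \<open>m *s x\<close> and
      \<open>r *s y\<close> passes through \<open>x + y\<close>. Its ends lie on the rays of
      \<open>x\<close> and \<open>y\<close>, which puts \<open>f (x + y)\<close> into the span of
      \<open>f x\<close> and \<open>f y\<close>.\<close>
    define r where "r = m / (m - 1)"
    define L where "L = aline (m *s x) (r *s y - m *s x)"
    define A where "A = aplane 0 (f x) (f y)"
    have r0: "r \<noteq> 0" using m by (simp add: r_def)
    have ne: "m *s x \<noteq> r *s y"
    proof
      assume e: "m *s x = r *s y"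
      have "x = (r / m) *s y"
        using arg_cong[OF e, of "\<lambda>z. (1 / m) *s z"] m by simp
      then show False using ind_sym[OF xy(3)] by (auto simp: ind_def)
    qed
    have xyL: "x + y = m *s x + ((m - 1) / m) *s (r *s y - m *s x)"
      using m by (simp add: r_def vec_eq_iff field_simps)
    have "f (m *s x) \<in> A" "f (r *s y) \<in> A"
    proof -
      obtain s where "f (m *s x) = 0 + s *s f x + 0 *s f y" using fscale[OF xy(1) x0, of m] by auto
      then show "f (m *s x) \<in> A" unfolding A_def in_aplane_iff by blast
      obtain s where "f (r *s y) = 0 + 0 *s f x + s *s f y" using fscale[OF xy(2) y0, of r] by auto
      then show "f (r *s y) \<in> A" unfolding A_def in_aplane_iff by blast
    qed
    moreover have "is_line (f ` L)"
      unfolding L_def by (rule good[OF is_line_aline sub]) (use ne xy Vs in auto)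
    ultimately have "f ` L \<subseteq> A"
      using ne image_line_subset_flat[OF f flat_aplane, of L "m *s x" "r *s y"]
      by (simp add: A_def L_def)
    moreover have "x + y \<in> L" unfolding L_def in_aline_iff using xyL by blast
    ultimately have "f (x + y) \<in> A" by blast
    then obtain \<alpha> \<beta> where ab: "f (x + y) = \<alpha> *s f x + \<beta> *s f y"
      by (auto simp: A_def in_aplane_iff)
    \<comment> \<open>Otherwise the image of the line \<open>x + \<langle>y\<rangle>\<close> would meet that of \<open>\<langle>y\<rangle>\<close>.\<close>
    have "\<alpha> = 1"
    proof (rule ccontr)
      assume a1: "\<alpha> \<noteq> 1"
      have xyM: "x + y \<in> aline x y" using end_in_aline[of "x + y" x] by simp
      have "is_line (f ` aline x y)" by (rule good[OF is_line_aline[OF y0] sub[OF xy(1,2)]])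
      then have M: "f ` aline x y = aline (f x) (f (x + y) - f x)"
        using y0 f xyM by (intro line_eq_join) (auto simp: inj_eq)
      have "(- \<beta> / (\<alpha> - 1)) *s f y = f x + (- 1 / (\<alpha> - 1)) *s (f (x + y) - f x)"
        using a1 by (simp add: ab vec_eq_iff divide_simps) (simp add: algebra_simps)
      then have "(- \<beta> / (\<alpha> - 1)) *s f y \<in> f ` aline x y" unfolding M in_aline_iff by blast
      then obtain s where "f (s *s y) \<in> f ` aline x y" using scalef[OF xy(2) y0] by metis
      then have "s *s y \<in> aline x y" using f by (auto simp: inj_eq)
      then obtain t where "s *s y = x + t *s y" by (auto simp: in_aline_iff)
      then have "x = (s - t) *s y" by (simp add: vec_eq_iff algebra_simps)
      then show False using ind_sym[OF xy(3)] unfolding ind_def by blast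
    qed
    then show ?thesis using ab by auto
  qed
  \<comment> \<open>Applying \<open>half\<close> to both orders of the summands and comparing
    coefficients makes both coefficients 1. The sums are padded below to fit
    \<open>aplane_inj\<close>.\<close>
  have add_ind: "f (x + y) = f x + f y" if xy: "x \<in> V" "y \<in> V" "ind x y" for x y
  proof -
    obtain s where s: "f (x + y) = f x + s *s f y" using half[OF xy] by blast
    obtain s' where "f (y + x) = f y + s' *s f x" using half[OF xy(2,1) ind_sym[OF xy(3)]] by blast
    then have "0 + 1 *s f x + s *s f y = 0 + s' *s f x + 1 *s f y" using s by (simp add: add.commute)
    then have "s = 1"
      using aplane_inj[of "f x" "f y"] find[OF xy(1,3)] unfolding ind_def by metis
    then show ?thesis using s by simp
  qed
  have add: "f (x + y) = f x + f y" if xy: "x \<in> V" "y \<in> V" for x y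
  proof (cases "x = 0 \<or> y = 0 \<or> ind x y")
    case True then show ?thesis using add_ind[OF xy] f0 by auto
  next
    case False
    then obtain t where t: "y = t *s x" and x0: "x \<noteq> 0" and y0: "y \<noteq> 0" by (auto simp: ind_def)
    \<comment> \<open>For dependent \<open>x\<close> and \<open>y\<close>, add a vector
      \<open>w\<close> off their line and expand \<open>f (x + y + w)\<close> in two ways; each
      expansion only splits independent vectors or a zero summand.\<close>
    obtain w where w: "w \<in> V" "\<And>s. w \<noteq> s *s x" using dim2[OF xy(1)] by blast
    have 1: "f ((x + y) + w) = f (x + y) + f w"
    proof (cases "x + y = 0")
      case False
      have "w \<noteq> s *s (x + y)" for s
      proof -
        have "s *s (x + y) = (s * (1 + t)) *s x" by (simp add: t vec_eq_iff algebra_simps)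
        then show ?thesis using w(2) by metis
      qed
      then show ?thesis using False w xy Vs by (intro add_ind) (auto simp: ind_def)
    qed (simp add: f0)
    have 2: "f (x + (y + w)) = f x + f (y + w)"
    proof (intro add_ind)
      have "y + w \<noteq> s *s x" for s
      proof
        assume "y + w = s *s x"
        then have "w = (s - t) *s x" by (simp add: t vec_eq_iff algebra_simps)
        then show False using w(2) by blast
      qed
      then show "ind x (y + w)" using x0 by (simp add: ind_def)
    qed (use xy w Vs in auto)
    have 3: "f (y + w) = f y + f w"
    proof (intro add_ind)
      have "w \<noteq> s *s y" for s using w(2)[of "s * t"] by (simp add: t)
      then show "ind y w" using y0 by (simp add: ind_def)
    qed (use xy w in auto)
    show ?thesis using 1 2 3 by (simp add: add.assoc)
  qed
  obtain e where e: "e \<in> V" "e \<noteq> 0"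
    using dim2[OF vec.subspace_0[OF V]] by auto
  define \<sigma> where "\<sigma> \<alpha> = (SOME s. f (\<alpha> *s e) = s *s f e)" for \<alpha>
  have \<sigma>e: "f (\<alpha> *s e) = \<sigma> \<alpha> *s f e" for \<alpha>
    unfolding \<sigma>_def using fscale[OF e] by (rule someI_ex)
  \<comment> \<open>Expanding \<open>f (\<alpha> *s (x + y))\<close> both by the ray of
    \<open>x + y\<close> and by additivity shows that independent \<open>x\<close> and
    \<open>y\<close> scale by the same factor.\<close>
  have transfer: "f (\<alpha> *s y) = s *s f y"
    if xy: "x \<in> V" "y \<in> V" "ind x y" and s: "f (\<alpha> *s x) = s *s f x" for x y \<alpha> s
  proof -
    have y0: "y \<noteq> 0" using ind_sym[OF xy(3)] by (simp add: ind_def)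
    have "x + y \<noteq> 0"
    proof
      assume "x + y = 0"
      then have "y = (- 1) *s x" by (simp add: vec_eq_iff add_eq_0_iff)
      then show False using xy(3) unfolding ind_def by blast
    qed
    then obtain r where r: "f (\<alpha> *s (x + y)) = r *s f (x + y)"
      using fscale[of "x + y"] xy Vs by blast
    obtain s' where s': "f (\<alpha> *s y) = s' *s f y" using fscale[OF xy(2) y0] by blast
    have "f (\<alpha> *s (x + y)) = s *s f x + s' *s f y"
      using add[of "\<alpha> *s x" "\<alpha> *s y"] xy Vs s s' by (simp add: vec.scale_right_distrib)
    then have "0 + r *s f x + r *s f y = 0 + s *s f x + s' *s f y"
      using r add[OF xy(1,2)] by (simp add: vec.scale_right_distrib)
    then have "r = s \<and> r = s'"
      using aplane_inj[of "f x" "f y"] find[OF xy(1,3)] unfolding ind_def by metis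
    then have "s' = s" by auto
    then show ?thesis using s' by simp
  qed
  have semi: "f (\<alpha> *s x) = \<sigma> \<alpha> *s f x" if x: "x \<in> V" for \<alpha> x
  proof (cases "x = 0 \<or> ind e x")
    case True then show ?thesis using transfer[OF e(1) x _ \<sigma>e] f0 by auto
  next
    case False
    \<comment> \<open>A multiple of \<open>e\<close> receives the factor in two transfers, from
      \<open>e\<close> to \<open>w\<close> and from \<open>w\<close> to \<open>x\<close>.\<close>
    obtain w where w: "w \<in> V" "\<And>t. w \<noteq> t *s e" using dim2[OF e(1)] by blast
    then have ew: "ind e w" using e(2) by (simp add: ind_def)
    obtain t where t: "x = t *s e" "x \<noteq> 0" using False e(2) by (auto simp: ind_def)
    have "ind x w" using w(2)[of "_ * t"] t by (auto simp: ind_def)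
    then show ?thesis using transfer[OF w(1) x ind_sym transfer[OF e(1) w(1) ew \<sigma>e]] by blast
  qed
  have fe: "s = t" if "s *s f e = t *s f e" for s t using that fnz[OF e(2)] by simp
  have "field_automorphism \<sigma>"
    unfolding field_automorphism_def
  proof (intro conjI allI)
    have "inj \<sigma>"
    proof (rule injI)
      fix \<alpha> \<beta> assume "\<sigma> \<alpha> = \<sigma> \<beta>"
      then have "f (\<alpha> *s e) = f (\<beta> *s e)" by (simp add: \<sigma>e)
      then show "\<alpha> = \<beta>" using f e(2) by (simp add: inj_eq)
    qed
    then show "bij \<sigma>" by (simp add: bij_def finite_UNIV_inj_surj)
    show "\<sigma> 1 = 1" using \<sigma>e[of 1] by (intro fe) simp
    fix \<alpha> \<beta>
    have "\<sigma> (\<alpha> + \<beta>) *s f e = f (\<alpha> *s e + \<beta> *s e)"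
      unfolding \<sigma>e[symmetric] vec.scale_left_distrib ..
    also have "\<dots> = (\<sigma> \<alpha> + \<sigma> \<beta>) *s f e"
      using add[of "\<alpha> *s e" "\<beta> *s e"] e(1) Vs by (simp add: \<sigma>e vec.scale_left_distrib)
    finally show "\<sigma> (\<alpha> + \<beta>) = \<sigma> \<alpha> + \<sigma> \<beta>" by (rule fe)
    have "\<sigma> (\<alpha> * \<beta>) *s f e = f (\<alpha> *s (\<beta> *s e))"
      unfolding \<sigma>e[symmetric] by simp
    also have "\<dots> = (\<sigma> \<alpha> * \<sigma> \<beta>) *s f e"
      using semi[of "\<beta> *s e" \<alpha>] e(1) Vs by (simp add: \<sigma>e del: vec.scale_scale)
    finally show "\<sigma> (\<alpha> * \<beta>) = \<sigma> \<alpha> * \<sigma> \<beta>" by (rule fe)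
  qed
  then show ?thesis using add semi by blast
qed

section \<open>Gluing semi-affine maps given on two hyperplanes\<close>

lemma kernel_not_in_line:
  fixes a :: "'a::{field,finite} ^ 'n::finite"
  assumes "CARD('n) \<ge> 3" "a \<noteq> 0"
  shows "\<exists>w \<in> hplane a 0. \<forall>t. w \<noteq> t *s x"
proof -
  have "card (aline 0 x) \<le> CARD('a)" unfolding aline_def by (rule card_image_le) simp
  also have "\<dots> < CARD('a) ^ (CARD('n) - 1)"
    using power_strict_increasing[of 1 "CARD('n) - 1" "CARD('a)"] assms(1)
      card_mono[of UNIV "{0, 1::'a}"] by simp
  also have "\<dots> = card (hplane a 0)" by (simp add: card_hplane[OF assms(2)])
  finally have "\<not> hplane a 0 \<subseteq> aline 0 x" using card_mono[of "aline 0 x" "hplane a 0"] by auto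
  then show ?thesis by (auto simp: in_aline_iff)
qed

lemma not_multiple_sym:
  fixes a b :: "'a::field ^ 'n"
  assumes "a \<noteq> 0" "\<And>t. b \<noteq> t *s a"
  shows "b \<noteq> 0" "\<And>t. a \<noteq> t *s b"
proof -
  show "b \<noteq> 0" using assms(2)[of 0] by simp
  fix t show "a \<noteq> t *s b"
  proof
    assume a: "a = t *s b"
    then have "t \<noteq> 0" using assms(1) by auto
    then have "b = (1 / t) *s a" by (simp add: a)
    then show False using assms(2) by blast
  qed
qed

text \<open>With a common point \<open>p\<close> of the hyperplanes and its image moved to the
  origin, \<open>f\<close> is semilinear on each of the two kernels. The kernels share a nonzero
  vector, so the automorphisms agree, and their sum is the whole space, so the two maps determine
  one semilinear map.\<close>

lemma semiaffine_extension:
  fixes f :: "'a::{field,finite} ^ 'n::finite \<Rightarrow> 'a ^ 'n"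
  assumes q: "CARD('a) \<ge> 3" and n: "CARD('n) \<ge> 3" and f: "inj f"
    and ab: "a \<noteq> 0" "\<And>t. b \<noteq> t *s a"
    and goodc: "\<And>L. is_line L \<Longrightarrow> L \<subseteq> hplane a c \<Longrightarrow> is_line (f ` L)"
    and goodd: "\<And>L. is_line L \<Longrightarrow> L \<subseteq> hplane b d \<Longrightarrow> is_line (f ` L)"
  shows "\<exists>g \<in> AGammaL. \<forall>x \<in> hplane a c \<union> hplane b d. g x = f x"
proof -
  note ba = not_multiple_sym[OF ab]
  have n2: "CARD('n) \<ge> 2" using n by simp
  have big: "1 < CARD('a) ^ (CARD('n) - 2)" using q n by (intro one_less_power) auto
  have "{x. dotp a x = c \<and> dotp b x = d} \<noteq> {}"
    using card_hplane_Int[OF ab n2, of c d] big by (intro notI) simp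
  then obtain p where p: "dotp a p = c" "dotp b p = d" by blast
  \<comment> \<open>A nonzero \<open>e\<close> in both kernels exists because \<open>n >= 3\<close>;
    it is what forces \<open>\<tau> = \<sigma>\<close>.\<close>
  have "\<not> {x. dotp a x = 0 \<and> dotp b x = 0} \<subseteq> {0}"
    using card_hplane_Int[OF ab n2, of 0 0] big card_mono[of "{0}" "{x. dotp a x = 0 \<and> dotp b x = 0}"]
    by auto
  then obtain e where e: "dotp a e = 0" "dotp b e = 0" "e \<noteq> 0" by blast
  obtain u' where u': "dotp b u' = 0" "dotp a u' \<noteq> 0"
    using exists_in_kernel_dotp_nonzero[OF ba] by blast
  define u where "u = (1 / dotp a u') *s u'"
  have u: "dotp b u = 0" "dotp a u = 1" using u' by (simp_all add: u_def)
  define h where "h x = f (p + x) - f p" for x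
  have h: "inj h" by (rule injI) (use f in \<open>simp add: h_def inj_eq\<close>)
  have h0: "h 0 = 0" by (simp add: h_def)
  have good: "is_line (h ` L)"
    if L: "is_line L" and H: "(\<lambda>x. x + p) ` L \<subseteq> H"
      and g: "\<And>L. is_line L \<Longrightarrow> L \<subseteq> H \<Longrightarrow> is_line (f ` L)" for H L
  proof -
    have "is_line ((\<lambda>x. x + p) ` L)" using is_line_image_AGammaL[OF translation_AGammaL L] .
    then have "is_line (f ` (\<lambda>x. x + p) ` L)" using g H by blast
    then have "is_line ((\<lambda>x. x + (- f p)) ` f ` (\<lambda>x. x + p) ` L)"
      using is_line_image_AGammaL[OF translation_AGammaL] by blast
    moreover have "h ` L = (\<lambda>x. x + (- f p)) ` f ` (\<lambda>x. x + p) ` L"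
      by (simp add: image_image h_def add.commute)
    ultimately show ?thesis by simp
  qed
  have gooda: "is_line (h ` L)" if "is_line L" "L \<subseteq> hplane a 0" for L
    by (rule good[where H = "hplane a c"]) (use that goodc p in auto)
  have goodb: "is_line (h ` L)" if "is_line L" "L \<subseteq> hplane b 0" for L
    by (rule good[where H = "hplane b d"]) (use that goodd p in auto)
  obtain \<sigma> where s: "field_automorphism \<sigma>" "\<And>\<alpha> x. dotp a x = 0 \<Longrightarrow> h (\<alpha> *s x) = \<sigma> \<alpha> *s h x"
    "\<And>x y. dotp a x = 0 \<Longrightarrow> dotp a y = 0 \<Longrightarrow> h (x + y) = h x + h y"
    using semilinear_on_subspace[OF q h h0 subspace_kernel kernel_not_in_line[OF n ab(1)] gooda]
    unfolding mem_Collect_eq Ball_def by blast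
  obtain \<tau> where t: "\<And>\<alpha> x. dotp b x = 0 \<Longrightarrow> h (\<alpha> *s x) = \<tau> \<alpha> *s h x"
    "\<And>x y. dotp b x = 0 \<Longrightarrow> dotp b y = 0 \<Longrightarrow> h (x + y) = h x + h y"
    using semilinear_on_subspace[OF q h h0 subspace_kernel kernel_not_in_line[OF n ba(1)] goodb]
    unfolding mem_Collect_eq Ball_def by blast
  have he: "h e \<noteq> 0" using e(3) h h0 by (metis inj_eq)
  have st: "\<tau> \<alpha> = \<sigma> \<alpha>" for \<alpha>
  proof -
    have "\<tau> \<alpha> *s h e = \<sigma> \<alpha> *s h e" using s(2)[OF e(1), of \<alpha>] t(1)[OF e(2), of \<alpha>] by simp
    then show ?thesis using he by simp
  qed
  \<comment> \<open>Splits \<open>x\<close> along the kernel of \<open>a\<close> and the vector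
    \<open>u\<close> of the kernel of \<open>b\<close>. For \<open>x\<close> in the kernel of
    \<open>b\<close> both parts lie in that kernel, so \<open>g\<close> agrees with \<open>h\<close>
    there too.\<close>
  define g where "g x = h (x - dotp a x *s u) + h (dotp a x *s u)" for x
  have g_add: "g (x + y) = g x + g y" for x y
  proof -
    have "h ((x + y) - dotp a (x + y) *s u) = h (x - dotp a x *s u) + h (y - dotp a y *s u)"
      by (subst s(3)[symmetric]) (simp_all add: u algebra_simps)
    moreover have "h (dotp a (x + y) *s u) = h (dotp a x *s u) + h (dotp a y *s u)"
      by (subst t(2)[symmetric]) (simp_all add: u algebra_simps)
    ultimately show ?thesis by (simp add: g_def)
  qed
  have g_scale: "g (\<alpha> *s x) = \<sigma> \<alpha> *s g x" for \<alpha> x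
  proof -
    have "h (\<alpha> *s x - dotp a (\<alpha> *s x) *s u) = \<sigma> \<alpha> *s h (x - dotp a x *s u)"
      by (subst s(2)[symmetric]) (simp_all add: u vec.scale_right_diff_distrib)
    moreover have "h (dotp a (\<alpha> *s x) *s u) = \<sigma> \<alpha> *s h (dotp a x *s u)"
      using t(1)[of "dotp a x *s u" \<alpha>] by (simp add: u st)
    ultimately show ?thesis by (simp add: g_def vec.scale_right_distrib)
  qed
  have ga: "g x = h x" if "dotp a x = 0" for x using that by (simp add: g_def h0)
  have gb: "g x = h x" if "dotp b x = 0" for x
    using that t(2)[of "x - dotp a x *s u" "dotp a x *s u"] by (simp add: g_def u)
  have "inj g"
  proof (rule injI)
    fix x y assume "g x = g y"
    define z where "z = x - y"
    have "g x = g z + g y" using g_add[of z y] by (simp add: z_def)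
    \<comment> \<open>Since \<open>g z = 0\<close>, the value of \<open>h\<close> at the part in the
      kernel of \<open>a\<close> is the negative of its value at the part along \<open>u\<close>.
      The injectivity of \<open>h\<close> on the whole space then gives
      \<open>z = 0\<close>.\<close>
    then have "h (z - dotp a z *s u) + h (dotp a z *s u) = 0" using \<open>g x = g y\<close> by (simp add: g_def)
    moreover have "h ((- dotp a z) *s u) + h (dotp a z *s u) = 0"
      using t(2)[of "(- dotp a z) *s u" "dotp a z *s u"] h0 by (simp add: u)
    ultimately have "h (z - dotp a z *s u) = h ((- dotp a z) *s u)" by (metis add_right_imp_eq)
    then have "z - dotp a z *s u = (- dotp a z) *s u" using h by (simp add: inj_eq)
    then have "z = 0" by simp
    then show "x = y" by (simp add: z_def)
  qed
  then have bg: "bij g" by (simp add: bij_def finite_UNIV_inj_surj)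
  define k where "k = (\<lambda>x. g x + f p) \<circ> (\<lambda>x. x + (- p))"
  have "k \<in> AGammaL" unfolding k_def
    by (rule AGammaL_comp[OF AGammaLI[OF bg g_add s(1) g_scale] translation_AGammaL])
  moreover have "k x = f x" if "x \<in> hplane a c \<union> hplane b d" for x
  proof -
    have "dotp a (x - p) = 0 \<or> dotp b (x - p) = 0" using that p by auto
    then have "g (x - p) = h (x - p)" using ga gb by blast
    then show ?thesis by (simp add: k_def h_def)
  qed
  ultimately show ?thesis by blast
qed

subsection \<open>Counting lines that meet the support of a permutation\<close>

text \<open>Semi-affine bijections preserve lines in both directions, so taking images under
  \<open>k\<close> is a bijection between the two sets of bad lines.\<close>

lemma card_bad_lines_AGammaL:
  fixes f :: "'a::field ^ 'n::finite \<Rightarrow> 'a ^ 'n"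
  assumes g: "g \<in> AGammaL" and k: "k \<in> AGammaL"
  shows "card (bad_lines (g \<circ> f \<circ> k)) = card (bad_lines f)"
proof (rule bij_betw_same_card)
  have b: "bij k" by (rule bij_AGammaL[OF k])
  have i1: "inv k ` k ` L = L" for L using b by (simp add: image_comp bij_is_inj)
  have i2: "k ` inv k ` L = L" for L using b by (simp add: image_comp bij_is_surj surj_iff[THEN iffD1])
  have e: "(g \<circ> f \<circ> k) ` L = g ` f ` k ` L" for L by (simp add: image_comp)
  have bad: "L \<in> bad_lines (g \<circ> f \<circ> k) \<longleftrightarrow> k ` L \<in> bad_lines f" for L
    unfolding mem_Collect_eq e is_line_image_AGammaL_iff[OF g] is_line_image_AGammaL_iff[OF k] ..
  show "bij_betw (image k) (bad_lines (g \<circ> f \<circ> k)) (bad_lines f)"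
  proof (rule bij_betw_byWitness[where f' = "image (inv k)"])
    show "\<forall>L\<in>bad_lines (g \<circ> f \<circ> k). inv k ` k ` L = L" by (intro ballI i1)
    show "\<forall>L\<in>bad_lines f. k ` inv k ` L = L" by (intro ballI i2)
    show "image k ` bad_lines (g \<circ> f \<circ> k) \<subseteq> bad_lines f"
      by (rule image_subsetI) (rule bad[THEN iffD1])
    show "image (inv k) ` bad_lines f \<subseteq> bad_lines (g \<circ> f \<circ> k)"
      by (rule image_subsetI, rule bad[THEN iffD2]) (simp only: i2)
  qed
qed

lemma lines_through_two_points:
  fixes z :: "'a::field ^ 'n::finite"
  assumes "y \<noteq> z"
  shows "{L. is_line L \<and> z \<in> L \<and> y \<in> L} = {aline z (y - z)}"
  using assms line_eq_join[of _ z y] by (auto intro: is_line_aline)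

text \<open>Every point other than \<open>z\<close> is on exactly one line through \<open>z\<close>,
  and each such line has \<open>q - 1\<close> of them. The product form avoids division.\<close>

lemma card_lines_through:
  fixes z :: "'a::{field,finite} ^ 'n::finite"
  shows "card {L. is_line L \<and> z \<in> L} * (CARD('a) - 1) = CARD('a) ^ CARD('n) - 1"
proof -
  have "(\<Sum>L\<in>{L. is_line L \<and> z \<in> L}. card {y \<in> UNIV - {z}. y \<in> L}) = 1 * card (UNIV - {z})"
  proof (rule sum_multicount)
    show "\<forall>y\<in>UNIV - {z}. card {L \<in> {L. is_line L \<and> z \<in> L}. y \<in> L} = 1"
    proof
      fix y assume "y \<in> UNIV - {z}"
      then have "{L. is_line L \<and> z \<in> L \<and> y \<in> L} = {aline z (y - z)}"
        by (intro lines_through_two_points) auto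
      moreover have "{L \<in> {L. is_line L \<and> z \<in> L}. y \<in> L} = {L. is_line L \<and> z \<in> L \<and> y \<in> L}"
        by auto
      ultimately show "card {L \<in> {L. is_line L \<and> z \<in> L}. y \<in> L} = 1" by simp
    qed
  qed auto
  moreover have "card {y \<in> UNIV - {z}. y \<in> L} = CARD('a) - 1" if "is_line L" "z \<in> L" for L
  proof -
    have "{y \<in> UNIV - {z}. y \<in> L} = L - {z}" by auto
    then show ?thesis using that by (simp add: card_line)
  qed
  ultimately show ?thesis by (simp add: card_Diff_singleton CARD_vec)
qed

text \<open>The line has at least two fixed points, so its image, if a line, is the line itself.
  Then \<open>h z\<close> would be a second moved point on it.\<close>

lemma tangent_line_bad:
  fixes h :: "'a::{field,finite} ^ 'n::finite \<Rightarrow> 'a ^ 'n"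
  assumes q: "CARD('a) \<ge> 3" and h: "inj h" and L: "is_line L" "L \<inter> {x. h x \<noteq> x} = {z}"
  shows "\<not> is_line (h ` L)"
proof
  assume hL: "is_line (h ` L)"
  have "card (L - {z}) = CARD('a) - 1" using L card_line[OF L(1)] by (subst card_Diff_singleton) auto
  then have "\<not> card (L - {z}) \<le> Suc 0" using q by simp
  then obtain x y where xy: "x \<in> L" "y \<in> L" "x \<noteq> z" "y \<noteq> z" "x \<noteq> y"
    by (auto simp: card_le_Suc0_iff_eq)
  then have fixed: "h x = x" "h y = y" using L(2) by blast+
  have "x \<in> h ` L" "y \<in> h ` L" using xy fixed by (metis image_eqI)+
  then have eq: "h ` L = L" using lines_eqI[OF hL L(1)] xy by blast
  have z: "z \<in> L" "h z \<noteq> z" using L(2) by auto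
  then have "h z \<in> L" using eq by blast
  moreover have "h (h z) \<noteq> h z" using z(2) h by (simp add: inj_eq)
  ultimately have "h z \<in> L \<inter> {x. h x \<noteq> x}" by simp
  then show False using L(2) z(2) by simp
qed

text \<open>Of the \<open>\<theta>\<close> lines through a moved point at most
  \<open>card S - 1\<close> meet another moved point; the others are tangent, hence bad, and a line
  is tangent at no more than one point. If \<open>card S > \<theta>\<close>, the truncated
  difference makes the claim trivial.\<close>

lemma tangent_line_count:
  fixes h :: "'a::{field,finite} ^ 'n::finite \<Rightarrow> 'a ^ 'n"
  assumes q: "CARD('a) \<ge> 3" and h: "inj h"
    and \<theta>: "\<theta> * (CARD('a) - 1) = CARD('a) ^ CARD('n) - 1"
  defines "S \<equiv> {x. h x \<noteq> x}"
  shows "(\<theta> + 1 - card S) * card S \<le> card (bad_lines h)"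
proof -
  have "(\<theta> + 1 - card S) * card S \<le> 1 * 1 * card (bad_lines h)"
  proof (rule double_count[where R = "\<lambda>z L. L \<inter> S = {z}"])
    fix z assume z: "z \<in> S"
    define A where "A = {L. is_line L \<and> z \<in> L}"
    define J where "J = (\<lambda>y. aline z (y - z)) ` (S - {z})"
    have "card A * (CARD('a) - 1) = \<theta> * (CARD('a) - 1)"
      unfolding A_def using \<theta> by (simp only: card_lines_through)
    then have cA: "card A = \<theta>" using q by auto
    have "card J \<le> card (S - {z})" unfolding J_def by (rule card_image_le) simp
    then have cJ: "card J \<le> card S - 1" using z by (simp add: card_Diff_singleton)
    have "card S > 0" using z by (auto simp: card_gt_0_iff)
    then have "\<theta> + 1 - card S \<le> card A - card J" using cA cJ by simp
    also have "\<dots> \<le> card (A - J)" by (rule diff_card_le_card_Diff) simp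
    also have "\<dots> \<le> card {L \<in> bad_lines h. L \<inter> S = {z}}"
    proof (rule card_mono)
      show "A - J \<subseteq> {L \<in> bad_lines h. L \<inter> S = {z}}"
      proof
        fix L assume L: "L \<in> A - J"
        have "y = z" if y: "y \<in> L" "y \<in> S" for y
        proof (rule ccontr)
          assume "y \<noteq> z"
          then have "L = aline z (y - z)" using L y line_eq_join[of L z y] by (auto simp: A_def)
          then show False using L y \<open>y \<noteq> z\<close> by (auto simp: J_def)
        qed
        then have "L \<inter> S = {z}" using L z by (auto simp: A_def)
        moreover have "is_line L" using L by (simp add: A_def)
        ultimately show "L \<in> {L \<in> bad_lines h. L \<inter> S = {z}}"
          using tangent_line_bad[OF q h] by (simp add: S_def)
      qed
    qed simp
    finally show "\<theta> + 1 - card S \<le> 1 * card {L \<in> bad_lines h. L \<inter> S = {z}}" by simp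
  next
    fix L assume "L \<in> bad_lines h"
    show "card {z \<in> S. L \<inter> S = {z}} \<le> 1"
      by (simp add: card_le_Suc0_iff_eq)
  qed auto
  then show ?thesis by simp
qed

text \<open>A line from a moved point \<open>z\<close> through distinct points of the two fixed
  hyperplanes has two fixed points. If it is good it is mapped to itself, so it contains
  \<open>h z\<close> and must be the line from \<open>z\<close> to \<open>h z\<close>; thus at most
  one is good. Conversely, such a line has at most \<open>q - 2\<close> moved points.\<close>

lemma crossing_line_count:
  fixes h :: "'a::{field,finite} ^ 'n::finite \<Rightarrow> 'a ^ 'n"
  assumes q: "CARD('a) \<ge> 3" and n: "CARD('n) \<ge> 3" and h: "inj h"
    and ab: "a \<noteq> 0" "\<And>t. b \<noteq> t *s a"
    and hfix: "\<And>x. x \<in> hplane a c \<union> hplane b d \<Longrightarrow> h x = x"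
  defines "S \<equiv> {x. h x \<noteq> x}"
  shows "((CARD('a) - 2) * CARD('a) ^ (CARD('n) - 2) - (if CARD('a) = 3 then 0 else 1)) * card S
    \<le> (CARD('a) - 2) * card (bad_lines h)"
proof -
  let ?q = "CARD('a)" and ?n = "CARD('n)"
  \<comment> \<open>The points of the first hyperplane off the second one, and off its parallel
    through \<open>z\<close>, so that the line from \<open>z\<close> still crosses the second
    hyperplane, in a different point.\<close>
  define E where "E z = {x. dotp a x = c \<and> dotp b x \<noteq> d \<and> dotp b x \<noteq> dotp b z}" for z
  define l where "l z x = aline z (x - z)" for z x :: "'a ^ 'n"
  define R where "R z L \<longleftrightarrow> (\<exists>x \<in> E z. L = l z x)" for z L
  have zS: "dotp a z \<noteq> c" "dotp b z \<noteq> d" if "z \<in> S" for z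
    using that hfix by (auto simp: S_def)
  have cardE: "(?q - 2) * ?q ^ (?n - 2) \<le> card (E z)" for z
  proof -
    have n2: "?n \<ge> 2" using n by simp
    let ?A = "{x. dotp a x = c \<and> dotp b x = d}" and ?B = "{x. dotp a x = c \<and> dotp b x = dotp b z}"
    have "(?q - 2) * ?q ^ (?n - 2) = ?q * ?q ^ (?n - 2) - 2 * ?q ^ (?n - 2)"
      by (rule diff_mult_distrib)
    also have "?q * ?q ^ (?n - 2) = ?q ^ (?n - 1)"
    proof -
      have "?n - 1 = Suc (?n - 2)" using n by simp
      then show ?thesis by simp
    qed
    also have "?q ^ (?n - 1) - 2 * ?q ^ (?n - 2) \<le> card (hplane a c) - card (?A \<union> ?B)"
      using card_Un_le[of ?A ?B] by (simp add: card_hplane[OF ab(1)] card_hplane_Int[OF ab n2])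
    also have "\<dots> \<le> card (hplane a c - (?A \<union> ?B))" by (rule diff_card_le_card_Diff) simp
    also have "hplane a c - (?A \<union> ?B) = E z" by (auto simp: E_def)
    finally show ?thesis .
  qed
  have l_line: "is_line (l z x)" and zl: "z \<in> l z x" and xl: "x \<in> l z x" if "z \<in> S" "x \<in> E z" for z x
    using that zS(1)[OF that(1)] by (auto simp: l_def E_def intro: is_line_aline)
  have second: "\<exists>x'. x' \<in> l z x \<and> x' \<noteq> x \<and> h x' = x' \<and> h x = x" if zx: "z \<in> S" "x \<in> E z" for z x
  proof -
    define x' where "x' = z + ((d - dotp b z) / (dotp b x - dotp b z)) *s (x - z)"
    have "dotp b x \<noteq> dotp b z" "dotp b x \<noteq> d" "dotp a x = c" using zx(2) by (auto simp: E_def)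
    then have "dotp b x' = d" unfolding x'_def dotp_simps by simp
    moreover have "x' \<in> l z x" unfolding x'_def l_def in_aline_iff by blast
    ultimately show ?thesis using hfix \<open>dotp b x \<noteq> d\<close> \<open>dotp a x = c\<close> by blast
  qed
  have inj_l: "inj_on (l z) (E z)" if z: "z \<in> S" for z
  proof (rule inj_onI)
    fix x y assume xy: "x \<in> E z" "y \<in> E z" "l z x = l z y"
    then have "y \<in> l z x" using xl[OF z] by blast
    then obtain t where t: "y = z + t *s (x - z)" by (auto simp: l_def in_aline_iff)
    have "dotp a y = dotp a x" using xy(1,2) by (simp add: E_def)
    then have "(t - 1) * (dotp a x - dotp a z) = 0" unfolding t dotp_simps by (simp add: algebra_simps)
    then have "t = 1" using xy(1) zS(1)[OF z] by (auto simp: E_def)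
    then show "x = y" using t by simp
  qed
  have goodD: "h ` l z x = l z x" if zx: "z \<in> S" "x \<in> E z" and g: "is_line (h ` l z x)" for z x
  proof -
    obtain x' where x': "x' \<in> l z x" "x' \<noteq> x" "h x' = x'" "h x = x" using second[OF zx] by blast
    have "x \<in> h ` l z x" "x' \<in> h ` l z x" using x' xl[OF zx] by (metis image_eqI)+
    then show ?thesis using lines_eqI[OF g l_line[OF zx]] x' xl[OF zx] by blast
  qed
  have "((?q - 2) * ?q ^ (?n - 2) - (if ?q = 3 then 0 else 1)) * card S
    \<le> 1 * (?q - 2) * card (bad_lines h)"
  proof (rule double_count[where R = R])
    fix z assume z: "z \<in> S"
    define I where "I = l z ` E z"
    define G where "G = {L \<in> I. is_line (h ` L)}"
    have cI: "card I = card (E z)" unfolding I_def by (rule card_image[OF inj_l[OF z]])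
    \<comment> \<open>For \<open>q = 3\<close> the line consists of \<open>z\<close> and its two
      fixed points, so it is tangent and the exception cannot occur. This case is needed because the
      estimate in \<open>support_card_eq_2\<close> would otherwise be too weak for
      \<open>q = 3\<close>, \<open>n = 3\<close>.\<close>
    have cG: "card G \<le> (if ?q = 3 then 0 else 1)"
    proof (cases "?q = 3")
      case True
      have "\<not> is_line (h ` l z x)" if x: "x \<in> E z" for x
      proof (rule tangent_line_bad[OF q h l_line[OF z x]])
        obtain x' where x': "x' \<in> l z x" "x' \<noteq> x" "h x' = x'" "h x = x" using second[OF z x] by blast
        have hz: "h z \<noteq> z" using z by (simp add: S_def)
        have "z \<noteq> x" "z \<noteq> x'" using x' hz by metis+
        then have "card {z, x, x'} = 3" using x'(2) by simp
        moreover have "card (l z x) = 3" using card_line[OF l_line[OF z x]] True by simp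
        moreover have "{z, x, x'} \<subseteq> l z x" using x' zl[OF z x] xl[OF z x] by simp
        ultimately have "l z x = {z, x, x'}" by (intro card_seteq[symmetric]) auto
        then show "l z x \<inter> {x. h x \<noteq> x} = {z}" using x' hz by auto
      qed
      then have "G = {}" by (auto simp: G_def I_def)
      then show ?thesis using True by simp
    next
      case False
      have "L = M" if LM: "L \<in> G" "M \<in> G" for L M
      proof -
        obtain x y where x: "x \<in> E z" "L = l z x" and y: "y \<in> E z" "M = l z y"
          using LM by (auto simp: G_def I_def)
        have "h ` L = L" "h ` M = M" using LM goodD z x y by (auto simp: G_def)
        then have "h z \<in> L" "h z \<in> M" using zl[OF z x(1)] zl[OF z y(1)] x y by blast+
        moreover have "h z \<noteq> z" using z by (simp add: S_def)
        ultimately show ?thesis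
          using lines_eqI[of L M "h z" z] l_line[OF z] zl[OF z] x y by blast
      qed
      then have "card G \<le> 1" by (auto simp: card_le_Suc0_iff_eq)
      then show ?thesis using False by simp
    qed
    have "(?q - 2) * ?q ^ (?n - 2) - (if ?q = 3 then 0 else 1) \<le> card I - card G"
      using cardE[of z] cI cG by linarith
    also have "\<dots> \<le> card (I - G)" by (rule diff_card_le_card_Diff) simp
    also have "\<dots> \<le> card {L \<in> bad_lines h. R z L}"
      by (rule card_mono) (use l_line[OF z] in \<open>auto simp: I_def G_def R_def\<close>)
    finally show "(?q - 2) * ?q ^ (?n - 2) - (if ?q = 3 then 0 else 1) \<le> 1 * card {L \<in> bad_lines h. R z L}"
      by simp
  next
    fix L assume L: "L \<in> bad_lines h"
    show "card {z \<in> S. R z L} \<le> ?q - 2"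
    proof (cases "{z \<in> S. R z L} = {}")
      case False
      then obtain z x where zx: "z \<in> S" "x \<in> E z" "L = l z x" by (auto simp: R_def)
      obtain x' where x': "x' \<in> L" "x' \<noteq> x" "h x' = x'" "h x = x" using second[OF zx(1,2)] zx(3) by blast
      have "{z \<in> S. R z L} \<subseteq> L - {x, x'}"
        using x' zl by (auto simp: R_def S_def)
      then have "card {z \<in> S. R z L} \<le> card (L - {x, x'})" by (intro card_mono) auto
      also have "\<dots> = ?q - 2"
        using x' xl[OF zx(1,2)] zx(3) L by (subst card_Diff_subset) (auto simp: card_line)
      finally show ?thesis .
    qed (metis card.empty zero_le)
  qed auto
  then show ?thesis by simp
qed

subsection \<open>Transpositions and the main theorem\<close>

text \<open>Makes all transpositions conjugate under \<open>AGammaL\<close>, so the double coset is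
  the same for every transposition.\<close>

lemma AGammaL_doubly_transitive:
  fixes a b c d :: "'a::{field,finite} ^ 'n::finite"
  assumes "a \<noteq> b" "c \<noteq> d"
  obtains k where "k \<in> AGammaL" "k a = c" "k b = d"
proof -
  define v where "v = b - a"
  define w where "w = d - c"
  have v: "v \<noteq> 0" and w: "w \<noteq> 0" using assms by (auto simp: v_def w_def)
  \<comment> \<open>For independent \<open>v\<close> and \<open>w\<close>, add two forms of which
    each vanishes on exactly one of them.\<close>
  have "\<exists>u. dotp v u \<noteq> 0 \<and> dotp w u \<noteq> 0"
  proof (cases "\<exists>t. w = t *s v")
    case True
    then obtain t where t: "w = t *s v" by blast
    then have "t \<noteq> 0" using w by auto
    moreover obtain u where "dotp v u \<noteq> 0" using exists_dotp_nonzero[OF v] by blast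
    ultimately show ?thesis using t by (auto simp: dotp_commute)
  next
    case False
    then have ind: "\<And>t. w \<noteq> t *s v" by blast
    obtain u1 where "dotp v u1 = 0" "dotp w u1 \<noteq> 0"
      using exists_in_kernel_dotp_nonzero[OF v ind] by blast
    moreover obtain u2 where "dotp w u2 = 0" "dotp v u2 \<noteq> 0"
      using exists_in_kernel_dotp_nonzero[OF not_multiple_sym[OF v ind]] by blast
    ultimately show ?thesis by (intro exI[of _ "u1 + u2"]) simp
  qed
  then obtain u' where u': "dotp u' v \<noteq> 0" "dotp u' w \<noteq> 0" by (auto simp: dotp_commute)
  define \<phi> where "\<phi> x = dotp u' x / dotp u' v" for x
  have \<phi>: "\<phi> v = 1" "\<phi> w \<noteq> 0" "\<phi> (x + y) = \<phi> x + \<phi> y" "\<phi> (t *s x) = t * \<phi> x" "\<phi> (x - y) = \<phi> x - \<phi> y" for x y t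
    using u' by (simp_all add: \<phi>_def add_divide_distrib diff_divide_distrib)
  \<comment> \<open>This sends \<open>v\<close> to \<open>w\<close> and is injective because \<open>\<phi> w \<noteq> 0\<close>.\<close>
  define g where "g x = x + \<phi> x *s (w - v)" for x
  have g_add: "g (x + y) = g x + g y" for x y
    by (simp add: g_def \<phi> vec_eq_iff algebra_simps)
  have g_scale: "g (t *s x) = t *s g x" for t x
    by (simp add: g_def \<phi> vec_eq_iff algebra_simps)
  have "inj g"
  proof (rule injI)
    fix x y assume "g x = g y"
    then have e: "x - y = (- \<phi> (x - y)) *s (w - v)"
      by (simp add: g_def \<phi> vec_eq_iff algebra_simps)
    have "\<phi> (x - y) = - \<phi> (x - y) * (\<phi> w - 1)"
      using arg_cong[OF e, of \<phi>] unfolding \<phi>(4) \<phi>(5)[of w v] \<phi>(1) .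
    then have "\<phi> (x - y) * \<phi> w = 0" by (simp add: algebra_simps)
    then have "\<phi> (x - y) = 0" using \<phi>(2) by simp
    then show "x = y" using e by simp
  qed
  then have "bij g" by (simp add: bij_def finite_UNIV_inj_surj)
  moreover have "field_automorphism (\<lambda>x::'a. x)"
    by (auto simp: field_automorphism_def bij_id[unfolded id_def])
  ultimately have "(\<lambda>x. g x + (c - g a)) \<in> AGammaL"
    using g_add g_scale by (intro AGammaLI)
  moreover have "g b = g a + w"
  proof -
    have "g v = w" by (simp add: g_def \<phi>)
    then show ?thesis using g_add[of a v] by (simp add: v_def)
  qed
  ultimately show thesis by (intro that[of "\<lambda>x. g x + (c - g a)"]) (auto simp: w_def)
qed

text \<open>Lines with both or neither of \<open>a\<close> and \<open>b\<close> are mapped to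
  themselves, lines with exactly one are tangent. Each of the two points is on
  \<open>\<theta> - 1\<close> lines that miss the other.\<close>

lemma card_bad_lines_transpose:
  fixes a b :: "'a::{field,finite} ^ 'n::finite"
  assumes q: "CARD('a) \<ge> 3" and ab: "a \<noteq> b"
    and \<theta>: "\<theta> * (CARD('a) - 1) = CARD('a) ^ CARD('n) - 1"
  shows "card (bad_lines (Transposition.transpose a b)) = 2 * (\<theta> - 1)"
proof -
  let ?t = "Transposition.transpose a b"
  have one: "card {L. is_line L \<and> x \<in> L \<and> y \<notin> L} = \<theta> - 1" if "x \<noteq> y" for x y :: "'a ^ 'n"
  proof -
    have "card {L. is_line L \<and> x \<in> L} * (CARD('a) - 1) = \<theta> * (CARD('a) - 1)"
      unfolding \<theta> by (rule card_lines_through)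
    then have "card {L. is_line L \<and> x \<in> L} = \<theta>" using q by auto
    moreover have "{L. is_line L \<and> x \<in> L \<and> y \<notin> L}
      = {L. is_line L \<and> x \<in> L} - {L. is_line L \<and> x \<in> L \<and> y \<in> L}" by auto
    moreover have "card {L. is_line L \<and> x \<in> L \<and> y \<in> L} = 1"
      using lines_through_two_points[of y x] that by simp
    ultimately show ?thesis by (simp add: card_Diff_subset Collect_mono)
  qed
  have supp: "{x. ?t x \<noteq> x} = {a, b}" using ab by (auto simp: Transposition.transpose_def)
  have "bad_lines ?t = {L. is_line L \<and> a \<in> L \<and> b \<notin> L} \<union> {L. is_line L \<and> b \<in> L \<and> a \<notin> L}"
  proof (intro set_eqI iffI)
    fix L assume L: "L \<in> bad_lines ?t"
    have "a \<in> L \<longleftrightarrow> b \<notin> L"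
    proof (rule ccontr)
      assume "\<not> ?thesis"
      then have "?t ` L = L" by (intro transpose_image_eq) simp
      then show False using L by simp
    qed
    then show "L \<in> {L. is_line L \<and> a \<in> L \<and> b \<notin> L} \<union> {L. is_line L \<and> b \<in> L \<and> a \<notin> L}"
      using L by auto
  next
    fix L assume "L \<in> {L. is_line L \<and> a \<in> L \<and> b \<notin> L} \<union> {L. is_line L \<and> b \<in> L \<and> a \<notin> L}"
    then have L: "is_line L" and "L \<inter> {a, b} = {a} \<or> L \<inter> {a, b} = {b}" by auto
    then have "\<not> is_line (?t ` L)"
      using tangent_line_bad[OF q _ L, of ?t] unfolding supp by (metis inj_on_transpose)
    then show "L \<in> bad_lines ?t" using L by simp
  qed
  then have "card (bad_lines ?t) = card {L. is_line L \<and> a \<in> L \<and> b \<notin> L} + card {L. is_line L \<and> b \<in> L \<and> a \<notin> L}"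
    by (simp only:) (rule card_Un_disjoint, auto)
  then show ?thesis using one[OF ab] one[OF ab[symmetric]] by simp
qed

lemma bij_moving_two_points:
  assumes "bij h" "card {x. h x \<noteq> x} = 2"
  obtains a b where "a \<noteq> b" "h = Transposition.transpose a b"
proof -
  obtain a b where ab: "{x. h x \<noteq> x} = {a, b}" "a \<noteq> b" using assms(2) by (auto simp: card_2_iff)
  have stay: "h x \<in> {a, b}" if "x \<in> {a, b}" for x
  proof -
    have "h x \<noteq> x" using that ab by blast
    then have "h (h x) \<noteq> h x" using assms(1) by (simp add: bij_is_inj inj_eq)
    then show ?thesis using ab(1) by blast
  qed
  have "h a = b" "h b = a" using stay[of a] stay[of b] ab by auto
  moreover have "h x = x" if "x \<noteq> a" "x \<noteq> b" for x using that ab(1) by blast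
  ultimately have "h x = Transposition.transpose a b x" for x by (simp add: Transposition.transpose_def)
  then show thesis using ab(2) that by blast
qed

text \<open>Here \<open>T\<close> stands for \<open>\<theta> - 1\<close>, \<open>s\<close> for the
  size of the support and \<open>B\<close> for the number of bad lines. The crossing bound excludes
  \<open>s >= T\<close>, the tangent bound excludes \<open>2 < s < T\<close>.\<close>

lemma support_card_eq_2:
  fixes q n s B T :: nat
  assumes q: "q \<ge> 3" and n: "n \<ge> 3" and s: "s \<ge> 2" and T: "T > 0" and B: "B \<le> 2 * T"
    and tangent: "(T + 2 - s) * s \<le> B"
    and crossing: "((q - 2) * q ^ (n - 2) - (if q = 3 then 0 else 1)) * s \<le> (q - 2) * B"
  shows "s = 2"
proof (rule ccontr)
  assume "s \<noteq> 2"
  then have s3: "s \<ge> 3" using s by simp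
  have Q: "q \<le> q ^ (n - 2)" using power_increasing[of 1 "n - 2" q] q n by simp
  have sT: "s < T"
  proof (rule ccontr)
    assume "\<not> s < T"
    define m where "m = (q - 2) * q ^ (n - 2) - (if q = 3 then 0 else 1)"
    have "m * T \<le> m * s" using \<open>\<not> s < T\<close> by simp
    also have "\<dots> \<le> (q - 2) * B" using crossing by (simp add: m_def)
    also have "\<dots> \<le> (q - 2) * (2 * T)" using B by (rule mult_le_mono2)
    finally have "m * T \<le> (2 * (q - 2)) * T" by (simp add: ac_simps)
    then have m: "m \<le> 2 * (q - 2)" using T by simp
    have le: "(q - 2) * q \<le> (q - 2) * q ^ (n - 2)" using Q by (rule mult_le_mono2)
    show False
    proof (cases "q = 3")
      case True then show False using m le by (simp add: m_def)
    next
      case False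
      then have "(q - 2) * 4 \<le> (q - 2) * q" using q by (intro mult_le_mono2) simp
      moreover have "(q - 2) * q ^ (n - 2) - 1 \<le> 2 * (q - 2)" using m False by (simp add: m_def)
      ultimately show False using le False q by linarith
    qed
  qed
  \<comment> \<open>With these, \<open>(T + 2 - s) * s = (j + 2) * (i + 2)\<close> exceeds
    \<open>2 * T\<close> by \<open>i * j\<close>.\<close>
  define i where "i = s - 2"
  define j where "j = T - s"
  have "s = i + 2" "T = i + 2 + j" "i > 0" "j > 0" using s3 sT by (auto simp: i_def j_def)
  then have "2 * T < (T + 2 - s) * s" by (simp add: algebra_simps)
  then show False using tangent B by simp
qed

text \<open>The bound \<open>few\<close> is not strict, so this serves both the inequality and its
  equality case.\<close>

lemma few_bad_lines_imp_transposition: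
  fixes f :: "'a::{field,finite} ^ 'n::finite \<Rightarrow> 'a ^ 'n"
  assumes q: "CARD('a) \<ge> 3" and n: "CARD('n) \<ge> 3" and f: "bij f" "f \<notin> AGammaL"
    and \<theta>: "\<theta> * (CARD('a) - 1) = CARD('a) ^ CARD('n) - 1"
    and few: "card (bad_lines f) \<le> 2 * (\<theta> - 1)"
  obtains g a b where "g \<in> AGammaL" "a \<noteq> b" "f = g \<circ> Transposition.transpose a b"
proof -
  let ?q = "CARD('a)" and ?n = "CARD('n)"
  have finj: "inj f" using f(1) by (rule bij_is_inj)
  have "(?q - 1) * (\<theta> - 1) = \<theta> * (?q - 1) - (?q - 1)"
    using diff_mult_distrib[of \<theta> 1 "?q - 1"] by (simp only: mult.commute mult_1_left mult_1_right)
  then have "(?q - 1) * (\<theta> - 1) = ?q ^ ?n - 1 - (?q - 1)" unfolding \<theta> .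
  then have Tq: "(?q - 1) * (\<theta> - 1) = ?q ^ ?n - ?q" using q by simp
  have "?q ^ 1 < ?q ^ ?n" using q n by (intro power_strict_increasing) auto
  then have Tpos: "\<theta> - 1 > 0" using Tq by (intro gr0I) simp
  have "(?q - 1) * card (bad_lines f) \<le> 2 * (?q ^ ?n - ?q)"
    using mult_le_mono2[OF few, of "?q - 1"] unfolding Tq[symmetric] by (simp only: ac_simps)
  then obtain a b c d where ab: "a \<noteq> 0" "\<And>t. b \<noteq> t *s a"
    and good: "\<And>L. is_line L \<Longrightarrow> L \<subseteq> hplane a c \<Longrightarrow> is_line (f ` L)"
      "\<And>L. is_line L \<Longrightarrow> L \<subseteq> hplane b d \<Longrightarrow> is_line (f ` L)"
    using two_good_hplanes[OF q n finj] by blast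
  obtain g where g: "g \<in> AGammaL" and gf: "\<And>x. x \<in> hplane a c \<union> hplane b d \<Longrightarrow> g x = f x"
    using semiaffine_extension[OF q n finj ab good] by blast
  have bg: "bij g" by (rule bij_AGammaL[OF g])
  define h where "h = inv g \<circ> f"
  have fgh: "f = g \<circ> h" using bg by (auto simp: h_def fun_eq_iff bij_is_surj surj_f_inv_f)
  have bh: "bij h" unfolding h_def by (rule bij_comp[OF f(1) bij_imp_bij_inv[OF bg]])
  then have hinj: "inj h" by (rule bij_is_inj)
  have hfix: "h x = x" if "x \<in> hplane a c \<union> hplane b d" for x
    using gf[OF that, symmetric] bg by (simp add: h_def bij_is_inj)
  have "bad_lines f = bad_lines h"
    unfolding fgh image_comp[symmetric] is_line_image_AGammaL_iff[OF g] ..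
  then have cB: "card (bad_lines h) \<le> 2 * (\<theta> - 1)" using few by simp
  define S where "S = {x. h x \<noteq> x}"
  have "S \<noteq> {}"
  proof
    assume "S = {}"
    then have "f = g" by (auto simp: fgh S_def)
    then show False using f(2) g by simp
  qed
  then obtain x where x: "h x \<noteq> x" by (auto simp: S_def)
  then have "h (h x) \<noteq> h x" using hinj by (simp add: inj_eq)
  then have "card {x, h x} \<le> card S" using x by (intro card_mono) (auto simp: S_def)
  then have S2: "card S \<ge> 2" using x by simp
  have "card S = 2"
  proof (rule support_card_eq_2[OF q n S2 Tpos cB])
    show "(\<theta> - 1 + 2 - card S) * card S \<le> card (bad_lines h)"
      using tangent_line_count[OF q hinj \<theta>] Tpos unfolding S_def by simp
    show "((?q - 2) * ?q ^ (?n - 2) - (if ?q = 3 then 0 else 1)) * card S \<le> (?q - 2) * card (bad_lines h)"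
      unfolding S_def by (rule crossing_line_count[OF q n hinj ab hfix])
  qed
  then obtain x y where "x \<noteq> y" "h = Transposition.transpose x y"
    using bij_moving_two_points[OF bh] unfolding S_def by blast
  then show thesis using that[OF g] fgh by blast
qed

theorem theorem8p4:
  fixes f :: "'a::{field,finite} ^ 'n::finite \<Rightarrow> 'a ^ 'n"
    and q n :: nat
  defines "q \<equiv> CARD('a)" and "n \<equiv> CARD('n)"
  assumes "q \<ge> 3" and "n \<ge> 3"
    and "f \<in> Per - AGammaL"
  shows "real (coaffinity1 f) \<ge> 2 * real q * gauss_binomial (real q) (n - 1) 1 \<and>
    2 * real q * gauss_binomial (real q) (n - 1) 1 = 2 * real q * (real q ^ (n - 1) - 1) / (real q - 1) \<and>
    (\<forall>\<tau> :: 'a ^ 'n \<Rightarrow> 'a ^ 'n. is_transposition \<tau> \<longrightarrow>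
       (real (coaffinity1 f) = 2 * real q * gauss_binomial (real q) (n - 1) 1 \<longleftrightarrow>
        f \<in> {g \<circ> \<tau> \<circ> h | g h. g \<in> AGammaL \<and> h \<in> AGammaL}))"
proof -
  have q: "CARD('a) \<ge> 3" and n: "CARD('n) \<ge> 3" using assms(3,4) by (auto simp: q_def n_def)
  have f: "bij f" "f \<notin> AGammaL" using assms(5) by (auto simp: Per_def)
  \<comment> \<open>The integer form of \<open>(q^n - 1) / (q - 1)\<close>; the bound of the theorem
    becomes \<open>2 * (\<theta> - 1)\<close>.\<close>
  define \<theta> where "\<theta> = card {L. is_line L \<and> (0 :: 'a ^ 'n) \<in> L}"
  have \<theta>: "\<theta> * (CARD('a) - 1) = CARD('a) ^ CARD('n) - 1"
    unfolding \<theta>_def by (rule card_lines_through)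
  have \<theta>1: "\<theta> \<ge> 1"
  proof (rule ccontr)
    assume "\<not> \<theta> \<ge> 1"
    then have "\<theta> = 0" by simp
    then have "CARD('a) ^ CARD('n) \<le> 1" using \<theta> by simp
    moreover have "1 < CARD('a) ^ CARD('n)" using q by (intro one_less_power) auto
    ultimately show False by simp
  qed
  have qpow: "real q * real q ^ (n - 1) = real q ^ n" using n by (simp add: n_def power_eq_if)
  have "real \<theta> * (real q - 1) = real q ^ n - 1"
  proof -
    have "real \<theta> * real (CARD('a) - 1) = real (CARD('a) ^ CARD('n) - 1)"
      using \<theta> by (metis of_nat_mult)
    then show ?thesis using q by (simp add: q_def n_def of_nat_diff)
  qed
  then have "real q * (real q ^ (n - 1) - 1) = (real \<theta> - 1) * (real q - 1)"
    using qpow by (simp add: algebra_simps)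
  then have bound: "2 * real q * (real q ^ (n - 1) - 1) / (real q - 1) = real (2 * (\<theta> - 1))"
    using assms(3) \<theta>1 by (simp add: divide_simps of_nat_diff) (simp add: algebra_simps)
  have gb: "2 * real q * gauss_binomial (real q) (n - 1) 1 = 2 * real q * (real q ^ (n - 1) - 1) / (real q - 1)"
    by (simp add: gauss_binomial_def)
  have co: "coaffinity1 f = card (bad_lines f)" by (simp add: coaffinity1_def)
  have lower: "2 * (\<theta> - 1) \<le> card (bad_lines f)"
  proof (rule ccontr)
    assume less: "\<not> ?thesis"
    \<comment> \<open>Too few bad lines would make \<open>f\<close> a transposition followed by a
      semi-affine map, and that has exactly \<open>2 * (\<theta> - 1)\<close> bad lines.\<close>
    then have "card (bad_lines f) \<le> 2 * (\<theta> - 1)" by simp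
    then obtain g a b where g: "g \<in> AGammaL" "a \<noteq> b" "f = g \<circ> Transposition.transpose a b"
      by (rule few_bad_lines_imp_transposition[OF q n f \<theta>])
    then have "bad_lines f = bad_lines (Transposition.transpose a b)"
      unfolding g(3) image_comp[symmetric] is_line_image_AGammaL_iff[OF g(1)] by simp
    then show False using card_bad_lines_transpose[OF q g(2) \<theta>] less by simp
  qed
  have "card (bad_lines f) = 2 * (\<theta> - 1) \<longleftrightarrow> f \<in> {g \<circ> \<tau> \<circ> h | g h. g \<in> AGammaL \<and> h \<in> AGammaL}"
    if trans: "is_transposition \<tau>" for \<tau> :: "'a ^ 'n \<Rightarrow> 'a ^ 'n"
  proof
    obtain c d where cd: "c \<noteq> d" "\<tau> = Transposition.transpose c d"
      using trans by (auto simp: is_transposition_def)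
    {
      assume "card (bad_lines f) = 2 * (\<theta> - 1)"
      then obtain g a b where g: "g \<in> AGammaL" "a \<noteq> b" "f = g \<circ> Transposition.transpose a b"
        by (rule few_bad_lines_imp_transposition[OF q n f \<theta> eq_imp_le])
      obtain k where k: "k \<in> AGammaL" "k a = c" "k b = d"
        using AGammaL_doubly_transitive[OF g(2) cd(1)] .
      have bk: "bij k" by (rule bij_AGammaL[OF k(1)])
      \<comment> \<open>Conjugation by \<open>k\<close>, which carries the pair \<open>a\<close>,
        \<open>b\<close> to \<open>c\<close>, \<open>d\<close>, replaces the transposition found by
        the given one.\<close>
      have "Transposition.transpose a b = inv k \<circ> \<tau> \<circ> k"
      proof
        fix x
        have "k (Transposition.transpose a b x) = \<tau> (k x)"
          using bk k by (auto simp: cd Transposition.transpose_def bij_is_inj inj_eq)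
        then show "Transposition.transpose a b x = (inv k \<circ> \<tau> \<circ> k) x"
          using bk by (metis bij_inv_eq_iff comp_apply)
      qed
      then have "f = (g \<circ> inv k) \<circ> \<tau> \<circ> k" by (simp add: g(3) comp_assoc)
      then show "f \<in> {g \<circ> \<tau> \<circ> h | g h. g \<in> AGammaL \<and> h \<in> AGammaL}"
        using AGammaL_comp[OF g(1) AGammaL_inv[OF k(1)]] k(1) by blast
    }
    assume "f \<in> {g \<circ> \<tau> \<circ> h | g h. g \<in> AGammaL \<and> h \<in> AGammaL}"
    then obtain g k where gk: "g \<in> AGammaL" "k \<in> AGammaL" "f = g \<circ> \<tau> \<circ> k" by blast
    show "card (bad_lines f) = 2 * (\<theta> - 1)"
      unfolding gk(3) card_bad_lines_AGammaL[OF gk(1,2)] cd(2)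
      by (rule card_bad_lines_transpose[OF q cd(1) \<theta>])
  qed
  then show ?thesis using lower unfolding gb bound co by (simp only: of_nat_le_iff of_nat_eq_iff) blast
qed

end
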